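(* Let $\mu\in\mathbb{R}$, $T>0$ and $r>1/2$. Assume that the exact solution $v$ of $$i\partial_t v=\mu\,\mathrm{e}^{-it\partial_x^2}\left(\mathrm{e}^{it\partial_x^2}v(t)\right)^2$$ on the one-dimensional torus $\mathbb{T}$ satisfies $v(t)\in H^r(\mathbb{T})$ for $0\le t\le T$. For a step size $\tau>0$ let $t_n=n\tau$, $v^0=v(0)$ and, for $n\ge0$, $$v^{n+1}=\left(1-2i\mu\tau\hat v_0^n\right)v^n+i\mu\tau(\hat v_0^n)^2+\frac{\mu}{2}\mathrm{e}^{-it_n\partial_x^2}\Big[\mathrm{e}^{-i\tau\partial_x^2}\left(\mathrm{e}^{i(t_n+\tau)\partial_x^2}\partial_x^{-1}v^n\right)^2-\left(\mathrm{e}^{it_n\partial_x^2}\partial_x^{-1}v^n\right)^2\Big].$$ Then there exists a constant $\tau_0>0$ such that for all step sizes $\tau\le\tau_0$ and all $t_n\le T$, $$\Vert v(t_n)-v^n\Vert_r\le c\,\tau,$$ where $c$ depends on $\sup_{0\le t\le T}\Vert v(t)\Vert_r$.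
   Context: $\mathbb{T}$ is the one-dimensional torus (period $2\pi$), functions are complex-valued with Fourier expansion $f(x)=\sum_{k\in\mathbb{Z}}\hat f_k\mathrm{e}^{ikx}$, and $\Vert\cdot\Vert_r$ is the standard Sobolev norm of $H^r=H^r(\mathbb{T})$, $\Vert f\Vert_r^2=\sum_k(1+|k|)^{2r}|\hat f_k|^2$. The operator $\mathrm{e}^{it\partial_x^2}$ multiplies $\hat f_k$ by $\mathrm{e}^{-itk^2}$, and $\partial_x^{-1}$ is the regularized inverse derivative $\partial_x^{-1}f(x)=\sum_{k\in\mathbb{Z}\setminus\{0\}}(ik)^{-1}\hat f_k\mathrm{e}^{ikx}$. $\hat v_0^n$ is the zeroth Fourier coefficient of $v^n$. The exact solution is understood in the mild sense, $$v(t)=v(0)-i\mu\int_0^t\mathrm{e}^{-is\partial_x^2}\left(\mathrm{e}^{is\partial_x^2}v(s)\right)^2\mathrm{d}s,$$ with finite supremum $\sup_{0\le t\le T}\Vert v(t)\Vert_r$. The constant $c$ may additionally depend on $r,\mu,T$, but neither $c$ nor $\tau_0$ depends on $\tau$ or $n$. *)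

theory Defs
  imports "HOL-Analysis.Analysis"
begin

text \<open>
  A function on the torus is a \<open>2\<pi>\<close>-periodic function on the real line. Elements of
  \<open>L\<^sup>2\<close> and \<open>H\<^sup>r\<close> are represented by individual functions rather than by classes modulo
  null sets: Fourier coefficients and norms do not depend on the representative, and equality
  of two elements is equality almost everywhere.
\<close>

definition fourier_coeff :: "(real \<Rightarrow> complex) \<Rightarrow> int \<Rightarrow> complex" where
  "fourier_coeff f k =
     (LINT x:{0..2*pi}|lebesgue. f x * exp (- (\<i> * of_int k * of_real x))) / (2 * of_real pi)"

definition torus_L2 :: "(real \<Rightarrow> complex) set" where
  "torus_L2 = {f. (\<forall>x. f (x + 2*pi) = f x) \<and>
     set_borel_measurable lebesgue {0..2*pi} f \<and>
     set_integrable lebesgue {0..2*pi} (\<lambda>x. (cmod (f x))\<^sup>2)}"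

definition sobolev :: "real \<Rightarrow> (real \<Rightarrow> complex) set" where
  "sobolev r = {f \<in> torus_L2.
     (\<lambda>k::int. (1 + \<bar>of_int k\<bar>) powr (2*r) * (cmod (fourier_coeff f k))\<^sup>2) summable_on UNIV}"

text \<open>Meaningful on \<^term>\<open>sobolev r\<close> only; elsewhere the infinite sum has a default value.\<close>

definition sobolev_norm :: "real \<Rightarrow> (real \<Rightarrow> complex) \<Rightarrow> real" where
  "sobolev_norm r f =
     sqrt (\<Sum>\<^sub>\<infinity>k::int. (1 + \<bar>of_int k\<bar>) powr (2*r) * (cmod (fourier_coeff f k))\<^sup>2)"

text \<open>
  The series is summed pointwise. For bounded symbols and functions in \<open>H\<^sup>r\<close> with
  \<open>r > 1/2\<close> it converges absolutely and uniformly, so that the result is the continuous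
  representative.
\<close>

definition fourier_multiplier :: "(int \<Rightarrow> complex) \<Rightarrow> (real \<Rightarrow> complex) \<Rightarrow> real \<Rightarrow> complex" where
  "fourier_multiplier m f x =
     (\<Sum>\<^sub>\<infinity>k::int. m k * fourier_coeff f k * exp (\<i> * of_int k * of_real x))"

text \<open>\<open>free_flow t\<close> is \<open>exp (i t \<partial>\<^sub>x\<^sup>2)\<close>.\<close>

definition free_flow :: "real \<Rightarrow> (real \<Rightarrow> complex) \<Rightarrow> real \<Rightarrow> complex" where
  "free_flow t = fourier_multiplier (\<lambda>k. exp (- (\<i> * of_real t * (of_int k)\<^sup>2)))"

definition inv_deriv :: "(real \<Rightarrow> complex) \<Rightarrow> real \<Rightarrow> complex" where
  "inv_deriv = fourier_multiplier (\<lambda>k. if k = 0 then 0 else inverse (\<i> * of_int k))"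

definition twisted_square :: "real \<Rightarrow> (real \<Rightarrow> complex) \<Rightarrow> real \<Rightarrow> complex" where
  "twisted_square s w = free_flow (- s) (\<lambda>y. (free_flow s w y)\<^sup>2)"

text \<open>
  Mild form of \<open>i \<partial>\<^sub>t v = \<mu> exp (- i t \<partial>\<^sub>x\<^sup>2) (exp (i t \<partial>\<^sub>x\<^sup>2) v)\<^sup>2\<close>. The
  \<open>H\<^sup>r\<close>-valued time integral is taken at each point \<open>x\<close>: for \<open>r > 1/2\<close> point evaluation
  of continuous representatives is a continuous functional on \<open>H\<^sup>r\<close> and hence commutes with the
  Bochner integral.
\<close>

definition mild_solution :: "real \<Rightarrow> real \<Rightarrow> (real \<Rightarrow> real \<Rightarrow> complex) \<Rightarrow> bool" where
  "mild_solution \<mu> T v \<longleftrightarrow>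
     (\<forall>t\<in>{0..T}.
        (\<forall>x. set_integrable lebesgue {0..t} (\<lambda>s. twisted_square s (v s) x)) \<and>
        (AE x in lebesgue.
           v t x = v 0 x - \<i> * of_real \<mu> * (LINT s:{0..t}|lebesgue. twisted_square s (v s) x)))"

definition integrator_step ::
  "real \<Rightarrow> real \<Rightarrow> real \<Rightarrow> (real \<Rightarrow> complex) \<Rightarrow> real \<Rightarrow> complex" where
  "integrator_step \<mu> \<tau> t w x =
     (1 - 2 * \<i> * of_real \<mu> * of_real \<tau> * fourier_coeff w 0) * w x
     + \<i> * of_real \<mu> * of_real \<tau> * (fourier_coeff w 0)\<^sup>2
     + of_real \<mu> / 2 *
       free_flow (- t)
         (\<lambda>y. free_flow (- \<tau>) (\<lambda>z. (free_flow (t + \<tau>) (inv_deriv w) z)\<^sup>2) y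
              - (free_flow t (inv_deriv w) y)\<^sup>2) x"

primrec integrator ::
  "real \<Rightarrow> real \<Rightarrow> (real \<Rightarrow> complex) \<Rightarrow> nat \<Rightarrow> real \<Rightarrow> complex" where
  "integrator \<mu> \<tau> w 0 = w"
| "integrator \<mu> \<tau> w (Suc n) = integrator_step \<mu> \<tau> (real n * \<tau>) (integrator \<mu> \<tau> w n)"

end

theory Submission imports Defs begin

text \<open>
  Written for Fourier coefficients, the equation for \<open>v\<close> is
  \<open>v\<^sub>k(t) = v\<^sub>k(0) - i \<mu> \<integral>\<^sub>0\<^sup>t (\<Sum>\<^sub>l exp (2 i s (k - l) l) v\<^sub>k\<^sub>-\<^sub>l(s) v\<^sub>l(s)) ds\<close>.
  The method replaces \<open>v(s)\<close> by \<open>v(t\<^sub>n)\<close> on each time step and integrates the phases exactly. This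
  is possible in closed form because the phase \<open>2 (k - l) l\<close> is a product: the factor that arises by
  integration is a product of two symbols of \<open>\<partial>\<^sub>x\<^sup>-\<^sup>1\<close>, and the terms with vanishing phase are those
  that involve the zeroth coefficient (\<open>frozen_integral\<close>, \<open>integrator_step_coeff\<close>).

  Convergence rests on one inequality. For \<open>r > 1/2\<close> the space \<open>H\<^sup>r\<close> is an algebra, and since
  the phases have modulus one, the quadratic term is bounded on \<open>H\<^sup>r\<close> uniformly in \<open>s\<close>
  (\<open>hs_bounded_twisted_conv\<close>). Hence the solution is Lipschitz continuous in time with values in
  \<open>H\<^sup>r\<close>, freezing it costs \<open>O(\<tau>)\<close> under an integral of length \<open>\<tau>\<close>, and the local error is
  \<open>O(\<tau>\<^sup>2)\<close>. The same inequality makes the scheme Lipschitz continuous with constant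
  \<open>1 + O(\<tau>)\<close> on bounded sets (\<open>one_step_error\<close>). A discrete Gronwall argument concludes; it
  also shows that the iterates remain bounded for small \<open>\<tau>\<close> (\<open>integrator_error\<close>).

  All estimates are made for sequences of coefficients. The passage from functions to
  sequences uses only absolutely convergent Fourier series, whose coefficients can be read off, and
  Fubini's theorem, which takes Fourier coefficients of the mild equation
  (\<open>mild_solution_coeff\<close>).
\<close>

section \<open>Weighted square-summable sequences\<close>

abbreviation abs_summable :: "('a \<Rightarrow> complex) \<Rightarrow> bool" where
  "abs_summable a \<equiv> (\<lambda>k. cmod (a k)) summable_on UNIV"

definition weight :: "real \<Rightarrow> int \<Rightarrow> real" where
  "weight r k = (1 + \<bar>real_of_int k\<bar>) powr r"

text \<open>
  A bound for the \<open>H\<^sup>r\<close> norm of a sequence of Fourier coefficients, stated through its finite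
  sections. In this form Minkowski's inequality for finite sums gives the triangle inequality,
  and bounds pass to pointwise limits.
\<close>

definition hs_bounded :: "real \<Rightarrow> (int \<Rightarrow> complex) \<Rightarrow> real \<Rightarrow> bool" where
  "hs_bounded r a C \<longleftrightarrow> (\<forall>F. finite F \<longrightarrow> L2_set (\<lambda>k. weight r k * cmod (a k)) F \<le> C)"

text \<open>
  Fourier coefficients of \<open>exp (- i s \<partial>\<^sub>x\<^sup>2) (exp (i s \<partial>\<^sub>x\<^sup>2) f \<cdot> exp (i s \<partial>\<^sub>x\<^sup>2) g)\<close>
  if \<open>a\<close> and \<open>b\<close> are those of \<open>f\<close> and \<open>g\<close>. The three phases combine into one because
  \<open>k\<^sup>2 - (k - l)\<^sup>2 - l\<^sup>2 = 2 (k - l) l\<close>.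
\<close>

definition twisted_conv :: "real \<Rightarrow> (int \<Rightarrow> complex) \<Rightarrow> (int \<Rightarrow> complex) \<Rightarrow> int \<Rightarrow> complex" where
  "twisted_conv s a b k = (\<Sum>\<^sub>\<infinity>l. cis (2 * s * of_int ((k - l) * l)) * (a (k - l) * b l))"

lemma weight_pos [simp]: "0 < weight r k" "0 \<le> weight r k" "weight r k \<noteq> 0"
proof -
  show "0 < weight r k" by (auto simp: weight_def powr_def)
  thus "0 \<le> weight r k" "weight r k \<noteq> 0" by auto
qed

lemma weight_add_le:
  assumes "0 \<le> r"
  shows "weight r (j + l) \<le> 2 powr r * (weight r j + weight r l)"
proof -
  let ?m = "max (1 + \<bar>real_of_int j\<bar>) (1 + \<bar>real_of_int l\<bar>)"
  have "weight r (j + l) \<le> (2 * ?m) powr r"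
  proof -
    have "1 + \<bar>real_of_int (j + l)\<bar> \<le> 2 * ?m"
      using abs_triangle_ineq[of "real_of_int j" "real_of_int l"]
        max.cobounded1[of "1 + \<bar>real_of_int j\<bar>" "1 + \<bar>real_of_int l\<bar>"]
        max.cobounded2[of "1 + \<bar>real_of_int l\<bar>" "1 + \<bar>real_of_int j\<bar>"]
      unfolding of_int_add by linarith
    thus ?thesis unfolding weight_def by (intro powr_mono2 assms) auto
  qed
  also have "\<dots> = 2 powr r * ?m powr r" by (simp add: powr_mult)
  also have "?m powr r \<le> weight r j + weight r l"
  proof -
    have "?m = 1 + \<bar>real_of_int j\<bar> \<or> ?m = 1 + \<bar>real_of_int l\<bar>" by (simp only: max_def) presburger
    thus ?thesis using weight_pos(2)[of r j] weight_pos(2)[of r l] unfolding weight_def by (elim disjE) simp_all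
  qed
  finally show ?thesis by simp
qed

lemma hs_boundedD:
  "hs_bounded r a C \<Longrightarrow> finite F \<Longrightarrow> L2_set (\<lambda>k. weight r k * cmod (a k)) F \<le> C"
  by (simp add: hs_bounded_def)

lemma hs_bounded_nonneg: "hs_bounded r a C \<Longrightarrow> 0 \<le> C"
  using hs_boundedD[of r a C "{}"] by simp

lemma hs_bounded_mono: "hs_bounded r a C \<Longrightarrow> C \<le> D \<Longrightarrow> hs_bounded r a D"
  unfolding hs_bounded_def by (meson order_trans)

lemma hs_bounded_add:
  assumes "hs_bounded r a C" "hs_bounded r b D"
  shows "hs_bounded r (\<lambda>k. a k + b k) (C + D)"
  unfolding hs_bounded_def
proof (intro allI impI)
  fix F :: "int set" assume F: "finite F"
  have "L2_set (\<lambda>k. weight r k * cmod (a k + b k)) F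
      \<le> L2_set (\<lambda>k. weight r k * cmod (a k) + weight r k * cmod (b k)) F"
    by (intro L2_set_mono) (auto simp flip: distrib_left intro: mult_left_mono norm_triangle_ineq)
  also have "\<dots> \<le> L2_set (\<lambda>k. weight r k * cmod (a k)) F + L2_set (\<lambda>k. weight r k * cmod (b k)) F"
    by (rule L2_set_triangle_ineq)
  also have "\<dots> \<le> C + D" by (intro add_mono hs_boundedD[OF _ F] assms)
  finally show "L2_set (\<lambda>k. weight r k * cmod (a k + b k)) F \<le> C + D" .
qed

lemma hs_bounded_cmult:
  assumes "hs_bounded r a C"
  shows "hs_bounded r (\<lambda>k. c * a k) (cmod c * C)"
  unfolding hs_bounded_def
proof (intro allI impI)
  fix F :: "int set" assume F: "finite F"
  have "L2_set (\<lambda>k. weight r k * cmod (c * a k)) F = cmod c * L2_set (\<lambda>k. weight r k * cmod (a k)) F"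
    by (simp add: L2_set_right_distrib norm_mult mult.left_commute)
  also have "\<dots> \<le> cmod c * C"
    by (intro mult_left_mono hs_boundedD[OF assms F]) simp
  finally show "L2_set (\<lambda>k. weight r k * cmod (c * a k)) F \<le> cmod c * C" .
qed

lemma hs_bounded_minus: "hs_bounded r a C \<Longrightarrow> hs_bounded r (\<lambda>k. - a k) C"
  by (simp add: hs_bounded_def)

lemma summable_weight:
  assumes "r > 1/2"
  shows "(\<lambda>k. (1 / weight r k)\<^sup>2) summable_on UNIV"
proof -
  let ?f = "\<lambda>k. (1 / weight r k)\<^sup>2"
  have f: "?f k = (1 + \<bar>real_of_int k\<bar>) powr (- (2 * r))" for k
  proof -
    have "(weight r k)\<^sup>2 = (1 + \<bar>real_of_int k\<bar>) powr (2 * r)"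
      using powr_power[of "1 + \<bar>real_of_int k\<bar>" r 2] by (simp add: weight_def mult.commute)
    thus ?thesis by (simp only: power_one_over powr_minus_divide)
  qed
  have "summable (\<lambda>n. real (Suc n) powr (- (2 * r)))"
    using assms by (subst summable_Suc_iff[of "\<lambda>n. real n powr (- (2 * r))"]) 
        (simp add: summable_real_powr_iff)
  hence "(\<lambda>n. ?f (int n)) summable_on UNIV"
    by (intro norm_summable_imp_summable_on) (simp add: f add.commute)
  hence 1: "?f summable_on range int"
    by (subst summable_on_reindex) (auto simp: o_def)
  hence "?f \<circ> uminus summable_on range int"
    by (simp add: o_def f)
  hence 2: "?f summable_on uminus ` range int"
    by (subst summable_on_reindex) auto
  have "UNIV = range int \<union> uminus ` range int"
  proof -
    have "k \<in> range int \<union> uminus ` range int" for k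
      by (cases k rule: int_cases2) auto
    thus ?thesis by blast
  qed
  thus ?thesis using summable_on_union[OF 1 2] by simp
qed

text \<open>
  The constant of the embedding of \<open>H\<^sup>r\<close> into the absolutely convergent Fourier series.
\<close>

definition embed_const :: "real \<Rightarrow> real" where
  "embed_const r = sqrt (\<Sum>\<^sub>\<infinity>k. (1 / weight r k)\<^sup>2)"

lemma embed_const_nonneg: "0 \<le> embed_const r"
  by (simp add: embed_const_def infsum_nonneg)

text \<open>
  Cauchy-Schwarz against the square-summable sequence \<open>1 / weight r\<close>.
\<close>

lemma hs_bounded_sum_le:
  assumes "r > 1/2" "hs_bounded r a C" "finite F"
  shows "(\<Sum>k\<in>F. cmod (a k)) \<le> embed_const r * C"
proof -
  have "(\<Sum>k\<in>F. cmod (a k)) = (\<Sum>k\<in>F. \<bar>1 / weight r k\<bar> * \<bar>weight r k * cmod (a k)\<bar>)"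
    by (intro sum.cong) (auto simp: abs_mult)
  also have "\<dots> \<le> L2_set (\<lambda>k. 1 / weight r k) F * L2_set (\<lambda>k. weight r k * cmod (a k)) F"
    by (rule L2_set_mult_ineq)
  also have "\<dots> \<le> embed_const r * C"
  proof (intro mult_mono)
    show "L2_set (\<lambda>k. 1 / weight r k) F \<le> embed_const r"
      unfolding L2_set_def embed_const_def
      by (intro real_sqrt_le_mono finite_sum_le_infsum summable_weight assms) auto
  qed (simp_all add: hs_boundedD[OF assms(2,3)] embed_const_nonneg)
  finally show ?thesis .
qed

lemma hs_bounded_abs_summable:
  assumes "r > 1/2" "hs_bounded r a C"
  shows "abs_summable a" and "(\<Sum>\<^sub>\<infinity>k. cmod (a k)) \<le> embed_const r * C"
proof -
  show *: "abs_summable a"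
    using hs_bounded_sum_le[OF assms] by (intro nonneg_bdd_above_summable_on bdd_aboveI2) auto
  show "(\<Sum>\<^sub>\<infinity>k. cmod (a k)) \<le> embed_const r * C"
    using hs_bounded_sum_le[OF assms] by (intro infsum_le_finite_sums *) auto
qed

definition algebra_const :: "real \<Rightarrow> real" where
  "algebra_const r = 2 powr r * (2 * embed_const r)"

lemma algebra_const_nonneg: "0 \<le> algebra_const r"
  by (simp add: algebra_const_def embed_const_nonneg)

lemma L2_set_sum_le:
  "L2_set (\<lambda>k. \<Sum>l\<in>G. f l k) F \<le> (\<Sum>l\<in>G. L2_set (f l) F)"
proof (induction G rule: infinite_finite_induct)
  case (insert x G)
  thus ?case using L2_set_triangle_ineq[of "f x" "\<lambda>k. \<Sum>l\<in>G. f l k" F] by simp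
qed (auto simp: L2_set_def)

lemma L2_set_translate_le:
  assumes "hs_bounded r a C" "finite F"
  shows "L2_set (\<lambda>k. weight r (k - l) * cmod (a (k - l))) F \<le> C"
proof -
  have "L2_set (\<lambda>k. weight r (k - l) * cmod (a (k - l))) F
      = L2_set (\<lambda>k. weight r k * cmod (a k)) ((\<lambda>k. k - l) ` F)"
    unfolding L2_set_def by (subst sum.reindex) (auto simp: inj_on_def)
  also have "\<dots> \<le> C"
    using assms by (intro hs_boundedD) auto
  finally show ?thesis .
qed

text \<open>
  The inequality \<open>\<parallel>A * b\<parallel>\<^sub>2 \<le> \<parallel>A\<parallel>\<^sub>2 \<parallel>b\<parallel>\<^sub>1\<close>: the convolution is a superposition of translates of
  \<open>A\<close>, which all have the same norm.
\<close>

lemma convolution_young: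
  assumes r: "r > 1/2" and a: "hs_bounded r a C" and b: "hs_bounded r b D"
    and fin: "finite F" "finite G"
  shows "L2_set (\<lambda>k. \<Sum>l\<in>G. weight r (k - l) * cmod (a (k - l)) * cmod (b l)) F
           \<le> embed_const r * C * D"
proof -
  have "L2_set (\<lambda>k. \<Sum>l\<in>G. weight r (k - l) * cmod (a (k - l)) * cmod (b l)) F
      \<le> (\<Sum>l\<in>G. L2_set (\<lambda>k. weight r (k - l) * cmod (a (k - l)) * cmod (b l)) F)"
    by (rule L2_set_sum_le)
  also have "\<dots> = (\<Sum>l\<in>G. L2_set (\<lambda>k. weight r (k - l) * cmod (a (k - l))) F * cmod (b l))"
    by (intro sum.cong refl L2_set_left_distrib[symmetric]) simp
  also have "\<dots> \<le> (\<Sum>l\<in>G. C * cmod (b l))"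
    by (intro sum_mono mult_right_mono L2_set_translate_le[OF a fin(1)]) simp
  also have "\<dots> \<le> embed_const r * C * D"
    using mult_left_mono[OF hs_bounded_sum_le[OF r b fin(2)] hs_bounded_nonneg[OF a]]
    by (simp add: sum_distrib_left mult.left_commute mult.assoc)
  finally show ?thesis .
qed

text \<open>
  The algebra property of \<open>H\<^sup>r\<close>. Since \<open>weight r k\<close> is bounded by a multiple of
  \<open>weight r (k - l) + weight r l\<close>, the weight can be moved to one of the two factors, and the other
  factor is summable.
\<close>

lemma finite_convolution_bound:
  assumes r: "r > 1/2" and a: "hs_bounded r a C" and b: "hs_bounded r b D"
    and fin: "finite F" "finite G"
  shows "L2_set (\<lambda>k. weight r k * (\<Sum>l\<in>G. cmod (a (k - l)) * cmod (b l))) F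
           \<le> algebra_const r * C * D"
proof -
  \<comment> \<open>When the weight falls on \<open>b\<close>, the sum is reindexed by
    \<open>m = k - l\<close>. The range of \<open>m\<close> then depends on \<open>k\<close>;
    \<open>H\<close> contains all of these ranges.\<close>
  define H where "H = (\<lambda>(k, l). k - l) ` (F \<times> G)"
  have H: "finite H" using fin by (simp add: H_def)
  let ?f = "\<lambda>k. \<Sum>l\<in>G. weight r (k - l) * cmod (a (k - l)) * cmod (b l)"
  let ?g = "\<lambda>k. \<Sum>m\<in>H. weight r (k - m) * cmod (b (k - m)) * cmod (a m)"
  have *: "weight r k * (\<Sum>l\<in>G. cmod (a (k - l)) * cmod (b l)) \<le> 2 powr r * (?f k + ?g k)"
    if k: "k \<in> F" for k
  proof -
    have "weight r k * (\<Sum>l\<in>G. cmod (a (k - l)) * cmod (b l))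
        \<le> (\<Sum>l\<in>G. 2 powr r * (weight r (k - l) + weight r l) * (cmod (a (k - l)) * cmod (b l)))"
      unfolding sum_distrib_left
      using weight_add_le[of r "k - l" l for l] r
      by (intro sum_mono mult_right_mono) (auto)
    also have "\<dots> = 2 powr r * (?f k + (\<Sum>l\<in>G. weight r l * cmod (b l) * cmod (a (k - l))))"
      by (simp add: sum_distrib_left sum.distrib algebra_simps)
    also have "(\<Sum>l\<in>G. weight r l * cmod (b l) * cmod (a (k - l)))
        = (\<Sum>m\<in>(\<lambda>l. k - l) ` G. weight r (k - m) * cmod (b (k - m)) * cmod (a m))"
      by (subst sum.reindex) (auto simp: inj_on_def)
    also have "\<dots> \<le> ?g k"
      by (intro sum_mono2 H) (use k in \<open>auto simp: H_def\<close>)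
    finally show ?thesis by simp
  qed
  have "L2_set (\<lambda>k. weight r k * (\<Sum>l\<in>G. cmod (a (k - l)) * cmod (b l))) F
      \<le> L2_set (\<lambda>k. 2 powr r * (?f k + ?g k)) F"
    by (intro L2_set_mono *) (auto intro!: sum_nonneg mult_nonneg_nonneg)
  also have "\<dots> = 2 powr r * L2_set (\<lambda>k. ?f k + ?g k) F" by (simp add: L2_set_right_distrib)
  also have "\<dots> \<le> 2 powr r * (L2_set ?f F + L2_set ?g F)"
    by (intro mult_left_mono L2_set_triangle_ineq) auto
  also have "\<dots> \<le> 2 powr r * (embed_const r * C * D + embed_const r * D * C)"
    by (intro mult_left_mono add_mono convolution_young r a b fin H) auto
  finally show ?thesis by (simp add: algebra_const_def algebra_simps)
qed

lemma convolution_abs_summable: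
  fixes a b :: "int \<Rightarrow> complex"
  assumes "abs_summable a" "abs_summable b"
  shows "abs_summable (\<lambda>(k, l). a (k - l) * b l)"
    and "abs_summable (\<lambda>l. a (k - l) * b l)"
proof -
  have "(\<lambda>p. cmod (case p of (j, l) \<Rightarrow> a j * b l)) summable_on UNIV \<times> UNIV"
    using assms
    by (subst Infinite_Sum.abs_summable_on_Sigma_iff)
       (auto simp: norm_mult infsum_cmult_right' abs_mult infsum_nonneg
          intro!: summable_on_cmult_left summable_on_cmult_right)
  also have "?this \<longleftrightarrow> (\<lambda>p. cmod (case p of (k, l) \<Rightarrow> a (k - l) * b l)) summable_on UNIV \<times> UNIV"
    by (subst summable_on_reindex_bij_betw[of "\<lambda>(k, l). (k - l, l)" "UNIV \<times> UNIV" "UNIV \<times> UNIV", symmetric])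
       (auto simp: case_prod_unfold intro!: bij_betwI[where g = "\<lambda>(j, l). (j + l, l)"])
  finally show *: "abs_summable (\<lambda>(k, l). a (k - l) * b l)" by simp
  hence "(\<lambda>(k, l). cmod (a (k - l) * b l)) summable_on UNIV \<times> UNIV"
    by (simp only: UNIV_Times_UNIV case_prod_unfold)
  from summable_on_SigmaD1[OF this UNIV_I]
  show "abs_summable (\<lambda>l. a (k - l) * b l)" .
qed

lemma twisted_conv_summable:
  fixes a b :: "int \<Rightarrow> complex"
  assumes "abs_summable a" "abs_summable b"
  shows "(\<lambda>l. cis (2 * s * of_int ((k - l) * l)) * (a (k - l) * b l)) summable_on UNIV"
  by (rule abs_summable_summable) (use convolution_abs_summable(2)[OF assms, of k] in \<open>simp add: norm_mult\<close>)

lemma twisted_conv_norm_le: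
  assumes "abs_summable a" "abs_summable b"
  shows "cmod (twisted_conv s a b k) \<le> (\<Sum>\<^sub>\<infinity>l. cmod (a (k - l)) * cmod (b l))"
proof -
  have "cmod (twisted_conv s a b k) \<le> (\<Sum>\<^sub>\<infinity>l. cmod (cis (2 * s * of_int ((k - l) * l)) * (a (k - l) * b l)))"
    unfolding twisted_conv_def using convolution_abs_summable(2)[OF assms, of k]
    by (intro norm_infsum_bound) (simp add: norm_mult)
  thus ?thesis by (simp add: norm_mult)
qed

text \<open>
  The phases have modulus one, so that the algebra property carries over with a constant that is
  uniform in \<open>s\<close>.
\<close>

lemma hs_bounded_twisted_conv:
  assumes r: "r > 1/2" and a: "hs_bounded r a C" and b: "hs_bounded r b D"
  shows "hs_bounded r (twisted_conv s a b) (algebra_const r * C * D)"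
  unfolding hs_bounded_def
proof (intro allI impI)
  fix F :: "int set" assume F: "finite F"
  note sa = hs_bounded_abs_summable(1)[OF r a] and sb = hs_bounded_abs_summable(1)[OF r b]
  let ?S = "\<lambda>G k. \<Sum>l\<in>G. cmod (a (k - l)) * cmod (b l)"
  let ?S' = "\<lambda>k. \<Sum>\<^sub>\<infinity>l. cmod (a (k - l)) * cmod (b l)"
  have "((\<lambda>G. ?S G k) \<longlongrightarrow> ?S' k) (finite_subsets_at_top UNIV)" for k
    using convolution_abs_summable(2)[OF sa sb, of k] by (intro infsum_tendsto) (simp add: norm_mult)
  hence lim: "((\<lambda>G. L2_set (\<lambda>k. weight r k * ?S G k) F) \<longlongrightarrow> L2_set (\<lambda>k. weight r k * ?S' k) F)
      (finite_subsets_at_top UNIV)"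
    unfolding L2_set_def by (intro tendsto_intros)
  have "L2_set (\<lambda>k. weight r k * cmod (twisted_conv s a b k)) F \<le> L2_set (\<lambda>k. weight r k * ?S' k) F"
    by (intro L2_set_mono mult_left_mono twisted_conv_norm_le sa sb) auto
  also have "\<dots> \<le> algebra_const r * C * D"
    by (rule tendsto_upperbound[OF lim]) 
       (auto intro!: eventually_finite_subsets_at_top_weakI finite_convolution_bound r a b F)
  finally show "L2_set (\<lambda>k. weight r k * cmod (twisted_conv s a b k)) F \<le> algebra_const r * C * D" .
qed

lemma twisted_conv_square_diff:
  assumes "abs_summable a" "abs_summable b"
  shows "twisted_conv s a a k - twisted_conv s b b k = twisted_conv s (\<lambda>k. a k - b k) a k + twisted_conv s b (\<lambda>k. a k - b k) k"
proof -
  have d: "abs_summable (\<lambda>k. a k - b k)"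
    by (rule Infinite_Sum.abs_summable_on_comparison_test'[OF summable_on_add[OF assms]]) (rule norm_triangle_ineq4)
  have "twisted_conv s (\<lambda>k. a k - b k) a k + twisted_conv s b (\<lambda>k. a k - b k) k + twisted_conv s b b k =
     (\<Sum>\<^sub>\<infinity>l. cis (2 * s * of_int ((k - l) * l)) * ((a (k - l) - b (k - l)) * a l)
        + cis (2 * s * of_int ((k - l) * l)) * (b (k - l) * (a l - b l))
        + cis (2 * s * of_int ((k - l) * l)) * (b (k - l) * b l))"
    unfolding twisted_conv_def
    by (simp only: infsum_add summable_on_add twisted_conv_summable[OF d assms(1)]
      twisted_conv_summable[OF assms(2) d] twisted_conv_summable[OF assms(2) assms(2)])
  also have "\<dots> = twisted_conv s a a k"
    unfolding twisted_conv_def by (intro infsum_cong) (simp add: algebra_simps)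
  finally show ?thesis by (simp add: algebra_simps)
qed

lemma
  fixes f :: "'b \<Rightarrow> 'a \<Rightarrow> 'c :: {banach, second_countable_topology}"
  assumes "\<And>i. i \<in> A \<Longrightarrow> set_integrable M S (f i)"
  shows set_integrable_sum: "set_integrable M S (\<lambda>x. \<Sum>i\<in>A. f i x)"
    and set_integral_sum:
      "set_lebesgue_integral M S (\<lambda>x. \<Sum>i\<in>A. f i x) = (\<Sum>i\<in>A. set_lebesgue_integral M S (f i))"
  using assms unfolding set_integrable_def set_lebesgue_integral_def
  by (simp_all add: scaleR_sum_right)

text \<open>
  Minkowski's integral inequality. If \<open>L\<close> is the norm of the integral on a finite section, then
  \<open>L\<^sup>2\<close> is the integral of an inner product with the integrand, hence at most \<open>L (q - p) C\<close> by
  Cauchy-Schwarz.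
\<close>

lemma hs_bounded_integral:
  fixes f :: "real \<Rightarrow> int \<Rightarrow> complex"
  assumes pq: "p \<le> q" and int: "\<And>k. set_integrable lebesgue {p..q} (\<lambda>s. f s k)"
    and bd: "\<And>s. s \<in> {p..q} \<Longrightarrow> hs_bounded r (f s) C"
  shows "hs_bounded r (\<lambda>k. LINT s:{p..q}|lebesgue. f s k) ((q - p) * C)"
  unfolding hs_bounded_def
proof (intro allI impI)
  fix A :: "int set" assume A: "finite A"
  have C: "0 \<le> C" using bd[of p] pq by (auto dest: hs_bounded_nonneg)
  define I where "I k = weight r k * cmod (LINT s:{p..q}|lebesgue. f s k)" for k
  define L where "L = L2_set I A"
  have I0: "0 \<le> I k" for k by (simp add: I_def)
  have L0: "0 \<le> L" by (simp add: L_def)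
  have "L\<^sup>2 = (\<Sum>k\<in>A. I k * I k)"
    by (simp add: L_def L2_set_def sum_nonneg flip: power2_eq_square)
  also have "\<dots> \<le> (\<Sum>k\<in>A. I k * (weight r k * (LINT s:{p..q}|lebesgue. cmod (f s k))))"
    by (intro sum_mono mult_left_mono I0)
       (auto simp: I_def intro!: mult_left_mono set_integral_norm_bound int)
  also have "\<dots> = (LINT s:{p..q}|lebesgue. (\<Sum>k\<in>A. I k * (weight r k * cmod (f s k))))"
    using set_integrable_norm[OF int]
    by (subst set_integral_sum) (auto simp: A)
  also have "\<dots> \<le> (LINT s:{p..q}|lebesgue. L * C)"
  proof (intro set_integral_mono)
    show "set_integrable lebesgue {p..q} (\<lambda>s. \<Sum>k\<in>A. I k * (weight r k * cmod (f s k)))"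
      using set_integrable_norm[OF int] by (intro set_integrable_sum set_integrable_mult_right) auto
    show "set_integrable lebesgue {p..q} (\<lambda>s. L * C)" by (intro absolutely_integrable_continuous_real) auto
    fix s assume s: "s \<in> {p..q}"
    have "(\<Sum>k\<in>A. I k * (weight r k * cmod (f s k))) = (\<Sum>k\<in>A. \<bar>I k\<bar> * \<bar>weight r k * cmod (f s k)\<bar>)"
      by (intro sum.cong) (auto simp: I0 abs_mult)
    also have "\<dots> \<le> L * L2_set (\<lambda>k. weight r k * cmod (f s k)) A"
      unfolding L_def by (rule L2_set_mult_ineq)
    also have "\<dots> \<le> L * C"
      by (rule mult_left_mono[OF hs_boundedD[OF bd[OF s] A] L0])
    finally show "(\<Sum>k\<in>A. I k * (weight r k * cmod (f s k))) \<le> L * C" .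
  qed
  also have "\<dots> = L * ((q - p) * C)"
    using pq by (simp add: set_lebesgue_integral_def)
  finally have "L * L \<le> L * ((q - p) * C)" by (simp add: power2_eq_square)
  hence "L \<le> (q - p) * C"
    using L0 C pq by (cases "L = 0") auto
  thus "L2_set (\<lambda>k. weight r k * cmod (LINT s:{p..q}|lebesgue. f s k)) A \<le> (q - p) * C"
    by (simp add: L_def I_def[abs_def])
qed

section \<open>Absolutely convergent Fourier series\<close>

lemma infsum_continuous_on:
  fixes f :: "'i \<Rightarrow> real \<Rightarrow> complex"
  assumes cont: "\<And>j. continuous_on S (f j)" and bound: "\<And>j s. s \<in> S \<Longrightarrow> cmod (f j s) \<le> c j"
    and c: "c summable_on UNIV"
  shows "continuous_on S (\<lambda>s. \<Sum>\<^sub>\<infinity>j. f j s)"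
proof (rule uniform_limit_theorem)
  show "uniform_limit S (\<lambda>J s. \<Sum>j\<in>J. f j s) (\<lambda>s. \<Sum>\<^sub>\<infinity>j. f j s) (finite_subsets_at_top UNIV)"
    by (rule Weierstrass_m_test_general[OF bound c])
qed (auto intro!: always_eventually continuous_on_sum cont)

lemma infsum_integral_has_sum:
  fixes f :: "'i \<Rightarrow> real \<Rightarrow> complex"
  assumes cont: "\<And>j. continuous_on {p..q} (f j)"
    and bound: "\<And>j s. s \<in> {p..q} \<Longrightarrow> cmod (f j s) \<le> c j" and c: "c summable_on UNIV"
  shows "((\<lambda>j. LINT s:{p..q}|lebesgue. f j s) has_sum (LINT s:{p..q}|lebesgue. \<Sum>\<^sub>\<infinity>j. f j s)) UNIV"
proof -
  note ai = absolutely_integrable_continuous_real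
  have "uniform_limit {p..q} (\<lambda>J s. \<Sum>j\<in>J. f j s) (\<lambda>s. \<Sum>\<^sub>\<infinity>j. f j s) (finite_subsets_at_top UNIV)"
    by (rule Weierstrass_m_test_general[OF bound c])
  then obtain I L where I: "\<And>J. ((\<lambda>s. \<Sum>j\<in>J. f j s) has_integral I J) {p..q}"
    and L: "((\<lambda>s. \<Sum>\<^sub>\<infinity>j. f j s) has_integral L) {p..q}" and lim: "(I \<longlongrightarrow> L) (finite_subsets_at_top UNIV)"
    by (rule uniform_limit_integral) (auto intro!: continuous_on_sum cont)
  have "L = (LINT s:{p..q}|lebesgue. \<Sum>\<^sub>\<infinity>j. f j s)"
    using L set_lebesgue_integral_eq_integral(2)[OF ai[OF infsum_continuous_on[OF cont bound c]]]
    by (simp add: integral_unique)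
  moreover have "I = (\<lambda>J. \<Sum>j\<in>J. LINT s:{p..q}|lebesgue. f j s)"
  proof
    fix J
    show "I J = (\<Sum>j\<in>J. LINT s:{p..q}|lebesgue. f j s)"
      using I[of J] set_lebesgue_integral_eq_integral(2)[OF ai[OF continuous_on_sum[of J, OF cont]]]
      by (simp add: integral_unique set_integral_sum[OF ai[OF cont]])
  qed
  ultimately show ?thesis using lim by (simp add: has_sum_def)
qed

lemma integral_cis:
  fixes \<theta> p q :: real
  assumes "\<theta> \<noteq> 0" "p \<le> q"
  shows "(LINT s:{p..q}|lebesgue. cis (\<theta> * s)) = (cis (\<theta> * q) - cis (\<theta> * p)) / (\<i> * of_real \<theta>)"
proof -
  have cis: "cis (\<theta> * s) = exp (\<i> * of_real \<theta> * of_real s)" for s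
    by (simp add: cis_conv_exp mult_ac)
  have "((\<lambda>s. cis (\<theta> * s)) has_integral cis (\<theta> * q) / (\<i> * of_real \<theta>) - cis (\<theta> * p) / (\<i> * of_real \<theta>)) {p..q}"
  proof (rule fundamental_theorem_of_calculus[OF assms(2)])
    fix s
    have "((\<lambda>z. exp (\<i> * of_real \<theta> * z) / (\<i> * of_real \<theta>)) has_field_derivative
        exp (\<i> * of_real \<theta> * of_real s)) (at (of_real s))"
      using assms by (auto intro!: derivative_eq_intros)
    from has_vector_derivative_real_field[OF this]
    show "((\<lambda>s. cis (\<theta> * s) / (\<i> * of_real \<theta>)) has_vector_derivative cis (\<theta> * s)) (at s within {p..q})"
      by (simp add: cis)
  qed
  moreover have "set_integrable lebesgue {p..q} (\<lambda>s. cis (\<theta> * s))"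
    by (intro absolutely_integrable_continuous_real continuous_intros)
  ultimately show ?thesis
    by (simp add: set_lebesgue_integral_eq_integral(2) integral_unique diff_divide_distrib)
qed

definition fourier_series :: "(int \<Rightarrow> complex) \<Rightarrow> real \<Rightarrow> complex" where
  "fourier_series a x = (\<Sum>\<^sub>\<infinity>k. a k * cis (of_int k * x))"

lemma abs_summable_bounded_mult:
  assumes "abs_summable a" "\<And>k. cmod (m k) \<le> 1"
  shows "abs_summable (\<lambda>k. m k * a k)"
  by (rule Infinite_Sum.abs_summable_on_comparison_test'[OF assms(1)])
     (simp add: norm_mult mult_left_le_one_le assms(2))

lemma fourier_series_summable:
  assumes "abs_summable a"
  shows "(\<lambda>k. a k * cis (of_int k * x)) summable_on UNIV"
  by (rule abs_summable_summable) (use assms in \<open>simp add: norm_mult\<close>)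

lemma fourier_series_norm_le:
  assumes "abs_summable a"
  shows "cmod (fourier_series a x) \<le> (\<Sum>\<^sub>\<infinity>k. cmod (a k))"
  using norm_infsum_bound[of "\<lambda>k. a k * cis (of_int k * x)" UNIV] assms
  by (simp add: fourier_series_def norm_mult)

lemma fourier_series_continuous:
  assumes "abs_summable a"
  shows "continuous_on S (fourier_series a)"
  unfolding fourier_series_def
  by (rule infsum_continuous_on[of _ _ "\<lambda>k. cmod (a k)"])
     (auto intro!: continuous_intros simp: norm_mult assms)

lemma cis_int_2pi: "cis (of_int k * (x + 2 * pi)) = cis (of_int k * x)"
proof -
  have "cis (of_int k * (x + 2 * pi)) = cis (of_int k * x) * cis (2 * pi * of_int k)"
    by (simp add: cis_mult ring_distribs mult_ac)
  thus ?thesis by (simp add: cis_multiple_2pi)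
qed

lemma fourier_series_periodic: "fourier_series a (x + 2 * pi) = fourier_series a x"
  by (simp add: fourier_series_def cis_int_2pi)

lemma fourier_coeff_alt:
  "fourier_coeff f k = (LINT x:{0..2*pi}|lebesgue. f x * cis (- of_int k * x)) / (2 * of_real pi)"
  by (simp add: fourier_coeff_def cis_conv_exp mult_ac)

lemma integral_cis_period:
  "(LINT x:{0..2*pi}|lebesgue. cis (of_int n * x)) = (if n = 0 then 2 * of_real pi else 0)"
proof (cases "n = 0")
  case True
  thus ?thesis by (simp add: set_lebesgue_integral_def scaleR_conv_of_real)
next
  case False
  have "cis (of_int n * (2 * pi)) = 1" using cis_int_2pi[of n 0] by simp
  thus ?thesis using False by (subst integral_cis) auto
qed

text \<open>
  Integration term by term and orthogonality of the characters. The nonlinear terms of the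
  equation and of the method are such series, so that this determines their coefficients.
\<close>

lemma fourier_coeff_fourier_series:
  assumes "abs_summable a"
  shows "fourier_coeff (fourier_series a) k = a k"
proof -
  have "((\<lambda>j. LINT x:{0..2*pi}|lebesgue. a j * cis (of_int j * x) * cis (- of_int k * x)) has_sum
     (LINT x:{0..2*pi}|lebesgue. \<Sum>\<^sub>\<infinity>j. a j * cis (of_int j * x) * cis (- of_int k * x))) UNIV"
    by (rule infsum_integral_has_sum[where c = "\<lambda>j. cmod (a j)"])
       (auto simp: norm_mult assms intro!: continuous_intros)
  also have "(\<lambda>x. \<Sum>\<^sub>\<infinity>j. a j * cis (of_int j * x) * cis (- of_int k * x)) = (\<lambda>x. fourier_series a x * cis (- of_int k * x))"
    by (simp add: fourier_series_def infsum_cmult_left')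
  also have "(\<lambda>j. LINT x:{0..2*pi}|lebesgue. a j * cis (of_int j * x) * cis (- of_int k * x))
      = (\<lambda>j. if j = k then a j * (2 * of_real pi) else 0)"
  proof
    fix j
    have "a j * cis (of_int j * x) * cis (- of_int k * x) = a j * cis (of_int (j - k) * x)" for x
      by (simp add: cis_mult algebra_simps)
    thus "(LINT x:{0..2*pi}|lebesgue. a j * cis (of_int j * x) * cis (- of_int k * x))
      = (if j = k then a j * (2 * of_real pi) else 0)"
      by (simp only: set_integral_mult_right integral_cis_period) simp
  qed
  finally have "((\<lambda>j. if j = k then a j * (2 * of_real pi) else 0) has_sum
     (LINT x:{0..2*pi}|lebesgue. fourier_series a x * cis (- of_int k * x))) UNIV" .
  moreover have "((\<lambda>j. if j = k then a j * (2 * of_real pi) else 0) has_sum a k * (2 * of_real pi)) UNIV"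
    by (rule has_sum_finite_neutralI[of "{k}"]) auto
  ultimately have "(LINT x:{0..2*pi}|lebesgue. fourier_series a x * cis (- of_int k * x)) = a k * (2 * of_real pi)"
    using has_sum_unique by blast
  thus ?thesis by (simp add: fourier_coeff_alt)
qed

lemma twisted_conv_abs_summable:
  assumes "abs_summable a" "abs_summable b"
  shows "abs_summable (twisted_conv s a b)"
proof -
  have "(\<lambda>(k, l). cmod (a (k - l) * b l)) summable_on UNIV \<times> UNIV"
    using convolution_abs_summable(1)[OF assms] by (simp only: UNIV_Times_UNIV case_prod_unfold)
  from summable_on_Sigma_banach[OF this]
  show ?thesis
    by (rule Infinite_Sum.abs_summable_on_comparison_test')
       (use twisted_conv_norm_le[OF assms] in \<open>simp add: norm_mult\<close>)
qed

lemma fourier_series_mult: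
  assumes a: "abs_summable a" and b: "abs_summable b"
  shows "fourier_series a x * fourier_series b x = fourier_series (\<lambda>k. \<Sum>\<^sub>\<infinity>l. a (k - l) * b l) x"
proof -
  let ?e = "\<lambda>k. cis (of_int k * x)"
  let ?A = "\<lambda>k. a k * ?e k" and ?B = "\<lambda>k. b k * ?e k"
  have AB: "abs_summable ?A" "abs_summable ?B" using a b by (simp_all add: norm_mult)
  have sum: "(\<lambda>(k, l). ?A (k - l) * ?B l) summable_on UNIV \<times> UNIV"
    by (rule abs_summable_summable)
       (use convolution_abs_summable(1)[OF AB] in \<open>simp only: UNIV_Times_UNIV\<close>)
  have e: "?A (k - l) * ?B l = a (k - l) * b l * ?e k" for k l
  proof -
    have "?e (k - l) * ?e l = ?e k" by (simp add: cis_mult algebra_simps)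
    thus ?thesis by (simp add: mult_ac)
  qed
  have "fourier_series (\<lambda>k. \<Sum>\<^sub>\<infinity>l. a (k - l) * b l) x = (\<Sum>\<^sub>\<infinity>k. \<Sum>\<^sub>\<infinity>l. ?A (k - l) * ?B l)"
    unfolding fourier_series_def e by (simp add: infsum_cmult_left')
  also have "\<dots> = (\<Sum>\<^sub>\<infinity>l. \<Sum>\<^sub>\<infinity>k. ?A (k - l) * ?B l)"
    by (rule infsum_swap_banach[OF sum])
  also have "\<dots> = (\<Sum>\<^sub>\<infinity>l. fourier_series a x * ?B l)"
  proof (rule infsum_cong)
    fix l
    have "(\<Sum>\<^sub>\<infinity>k. ?A (k - l)) = fourier_series a x"
      unfolding fourier_series_def
      by (rule infsum_reindex_bij_betw[of "\<lambda>k. k - l" UNIV UNIV ?A])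
         (auto intro!: bij_betwI[where g = "\<lambda>j. j + l"])
    thus "(\<Sum>\<^sub>\<infinity>k. ?A (k - l) * ?B l) = fourier_series a x * ?B l" by (simp only: infsum_cmult_left')
  qed
  also have "\<dots> = fourier_series a x * fourier_series b x" by (simp add: infsum_cmult_right' fourier_series_def)
  finally show ?thesis by simp
qed

lemma free_flow_fourier_series:
  "free_flow t f = fourier_series (\<lambda>k. cis (- (t * (of_int k)\<^sup>2)) * fourier_coeff f k)"
  by (rule ext) (simp add: free_flow_def fourier_multiplier_def fourier_series_def cis_conv_exp mult_ac)

lemma inv_deriv_fourier_series:
  "inv_deriv f = fourier_series (\<lambda>k. (if k = 0 then 0 else inverse (\<i> * of_int k)) * fourier_coeff f k)"
  by (rule ext) (simp add: inv_deriv_def fourier_multiplier_def fourier_series_def cis_conv_exp mult_ac)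

lemma twisted_conv_conjugation:
  "cis (s * (of_int k)\<^sup>2) * (\<Sum>\<^sub>\<infinity>l. (cis (- (s * (of_int (k - l))\<^sup>2)) * a (k - l)) * (cis (- (s * (of_int l)\<^sup>2)) * a l))
     = twisted_conv s a a k"
proof -
  have "cis (s * (of_int k)\<^sup>2) * ((cis (- (s * (of_int (k - l))\<^sup>2)) * a (k - l)) * (cis (- (s * (of_int l)\<^sup>2)) * a l))
      = cis (2 * s * of_int ((k - l) * l)) * (a (k - l) * a l)" for l
  proof -
    have "cis (s * (of_int k)\<^sup>2) * cis (- (s * (of_int (k - l))\<^sup>2)) * cis (- (s * (of_int l)\<^sup>2))
       = cis (s * (of_int k)\<^sup>2 - s * (of_int (k - l))\<^sup>2 - s * (of_int l)\<^sup>2)"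
      by (simp only: cis_mult diff_conv_add_uminus)
    also have "s * (of_int k)\<^sup>2 - s * (of_int (k - l))\<^sup>2 - s * (of_int l)\<^sup>2 = 2 * s * of_int ((k - l) * l)"
      by (simp add: power2_eq_square algebra_simps)
    finally show ?thesis by (simp only: mult_ac)
  qed
  thus ?thesis by (simp only: twisted_conv_def infsum_cmult_right'[symmetric])
qed

lemma free_flow_square_coeff:
  assumes "abs_summable (fourier_coeff w)"
  shows "(\<lambda>y. (free_flow s w y)\<^sup>2) = fourier_series (\<lambda>k. cis (- (s * (of_int k)\<^sup>2)) * twisted_conv s (fourier_coeff w) (fourier_coeff w) k)"
    and "fourier_coeff (\<lambda>y. (free_flow s w y)\<^sup>2) k = cis (- (s * (of_int k)\<^sup>2)) * twisted_conv s (fourier_coeff w) (fourier_coeff w) k"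
proof -
  let ?a = "fourier_coeff w"
  have s: "abs_summable (\<lambda>k. cis (- (s * (of_int k)\<^sup>2)) * ?a k)"
    by (intro abs_summable_bounded_mult assms) simp
  have c: "cis (- (s * (of_int k)\<^sup>2)) * twisted_conv s ?a ?a k =
      (\<Sum>\<^sub>\<infinity>l. (cis (- (s * (of_int (k - l))\<^sup>2)) * ?a (k - l)) * (cis (- (s * (of_int l)\<^sup>2)) * ?a l))" for k
    unfolding twisted_conv_conjugation[symmetric] mult.assoc[symmetric] cis_mult by simp
  show *: "(\<lambda>y. (free_flow s w y)\<^sup>2) = fourier_series (\<lambda>k. cis (- (s * (of_int k)\<^sup>2)) * twisted_conv s ?a ?a k)"
    by (rule ext) (simp only: c free_flow_fourier_series power2_eq_square[of "fourier_series _ _"] fourier_series_mult[OF s s])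
  show "fourier_coeff (\<lambda>y. (free_flow s w y)\<^sup>2) k = cis (- (s * (of_int k)\<^sup>2)) * twisted_conv s ?a ?a k"
    unfolding * by (intro fourier_coeff_fourier_series abs_summable_bounded_mult twisted_conv_abs_summable assms) simp
qed

lemma twisted_square_fourier_series:
  assumes "abs_summable (fourier_coeff w)"
  shows "twisted_square s w = fourier_series (twisted_conv s (fourier_coeff w) (fourier_coeff w))"
  unfolding twisted_square_def free_flow_fourier_series[of "- s"] free_flow_square_coeff(2)[OF assms]
  by (simp add: mult.assoc[symmetric] cis_mult)

section \<open>Linearity of Fourier coefficients and Sobolev norms\<close>

lemma set_borel_measurable_times_continuous:
  fixes f g :: "real \<Rightarrow> complex"
  assumes "set_borel_measurable lebesgue S f" "continuous_on UNIV g"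
  shows "set_borel_measurable lebesgue S (\<lambda>x. f x * g x)"
proof -
  have "g \<in> borel_measurable lebesgue"
    using assms(2) by (intro measurable_completion) (simp add: borel_measurable_continuous_onI)
  hence "(\<lambda>x. (indicator S x *\<^sub>R f x) * g x) \<in> borel_measurable lebesgue"
    using assms(1) unfolding set_borel_measurable_def by (intro borel_measurable_times)
  thus ?thesis by (simp add: set_borel_measurable_def)
qed

lemma set_integrable_times_character:
  assumes "set_integrable lebesgue {0..2*pi} f"
  shows "set_integrable lebesgue {0..2*pi} (\<lambda>x. f x * cis (c * x))"
proof (rule set_integrable_bound[OF assms])
  have "set_borel_measurable lebesgue {0..2*pi} f"
    using assms by (simp add: set_integrable_def set_borel_measurable_def borel_measurable_integrable)
  thus "set_borel_measurable lebesgue {0..2*pi} (\<lambda>x. f x * cis (c * x))"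
    by (rule set_borel_measurable_times_continuous) (intro continuous_intros)
qed (simp add: norm_mult)

lemma fourier_coeff_add:
  assumes "set_integrable lebesgue {0..2*pi} f" "set_integrable lebesgue {0..2*pi} g"
  shows "fourier_coeff (\<lambda>x. f x + g x) k = fourier_coeff f k + fourier_coeff g k"
  unfolding fourier_coeff_alt ring_distribs
    set_integral_add(2)[OF set_integrable_times_character[OF assms(1)] set_integrable_times_character[OF assms(2)]]
    add_divide_distrib ..

lemma fourier_coeff_cmult: "fourier_coeff (\<lambda>x. c * f x) k = c * fourier_coeff f k"
  unfolding fourier_coeff_alt by (simp only: mult.assoc set_integral_mult_right times_divide_eq_right)

lemma fourier_coeff_diff:
  assumes "set_integrable lebesgue {0..2*pi} f" "set_integrable lebesgue {0..2*pi} g"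
  shows "fourier_coeff (\<lambda>x. f x - g x) k = fourier_coeff f k - fourier_coeff g k"
  using fourier_coeff_add[OF assms(1) set_integrable_mult_right[of "-1", OF assms(2)]]
  by (simp add: fourier_coeff_cmult[of "-1", simplified])

lemma torus_L2_integrable:
  assumes "f \<in> torus_L2"
  shows "set_integrable lebesgue {0..2*pi} f"
proof (rule set_integrable_bound)
  show "set_integrable lebesgue {0..2*pi} (\<lambda>x. 1 + (cmod (f x))\<^sup>2)"
    using assms by (intro set_integral_add(1)) (auto simp: torus_L2_def intro: absolutely_integrable_continuous_real)
  show "set_borel_measurable lebesgue {0..2*pi} f" using assms by (simp add: torus_L2_def)
  have "y \<le> 1 + y\<^sup>2" for y :: real
    using zero_le_power2[of "y - 1/2"] by (simp add: power2_eq_square algebra_simps)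
  thus "AE x in lebesgue. x \<in> {0..2*pi} \<longrightarrow> norm (f x) \<le> norm (1 + (cmod (f x))\<^sup>2)"
    by (auto simp: abs_of_nonneg intro!: AE_I2)
qed

lemma fourier_series_integrable: "abs_summable a \<Longrightarrow> set_integrable lebesgue {p..q} (fourier_series a)"
  by (intro absolutely_integrable_continuous_real fourier_series_continuous)

lemma torus_L2_affine_combination:
  assumes w: "w \<in> torus_L2" and a: "abs_summable a"
  shows "(\<lambda>x. c * w x + fourier_series a x) \<in> torus_L2"
proof -
  let ?g = "\<lambda>x. c * w x + fourier_series a x"
  have per: "?g (x + 2 * pi) = ?g x" for x
    using w by (simp add: torus_L2_def fourier_series_periodic)
  have "set_integrable lebesgue {0..2*pi} ?g"
    by (intro set_integral_add(1) set_integrable_mult_right fourier_series_integrable torus_L2_integrable w a)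
  hence meas: "set_borel_measurable lebesgue {0..2*pi} ?g"
    by (simp add: set_integrable_def set_borel_measurable_def borel_measurable_integrable)
  have "set_integrable lebesgue {0..2*pi} (\<lambda>x. (cmod (?g x))\<^sup>2)"
  proof (rule set_integrable_bound)
    show "set_integrable lebesgue {0..2*pi} (\<lambda>x. 2 * (cmod c)\<^sup>2 * (cmod (w x))\<^sup>2 + 2 * (cmod (fourier_series a x))\<^sup>2)"
    proof (intro set_integral_add(1) set_integrable_mult_right)
      show "set_integrable lebesgue {0..2*pi} (\<lambda>x. (cmod (w x))\<^sup>2)" using w by (simp add: torus_L2_def)
      show "set_integrable lebesgue {0..2*pi} (\<lambda>x. (cmod (fourier_series a x))\<^sup>2)"
        by (intro absolutely_integrable_continuous_real continuous_intros fourier_series_continuous a)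
    qed
    have "(\<lambda>x. (cmod (indicator {0..2*pi} x *\<^sub>R ?g x))\<^sup>2) \<in> borel_measurable lebesgue"
      using meas unfolding set_borel_measurable_def by measurable
    also have "(\<lambda>x. (cmod (indicator {0..2*pi} x *\<^sub>R ?g x))\<^sup>2) = (\<lambda>x. indicator {0..2*pi} x *\<^sub>R (cmod (?g x))\<^sup>2)"
      by (auto simp: indicator_def)
    finally show "set_borel_measurable lebesgue {0..2*pi} (\<lambda>x. (cmod (?g x))\<^sup>2)"
      by (simp add: set_borel_measurable_def)
    have "(cmod (?g x))\<^sup>2 \<le> 2 * (cmod c)\<^sup>2 * (cmod (w x))\<^sup>2 + 2 * (cmod (fourier_series a x))\<^sup>2" for x
    proof -
      have "(cmod (?g x))\<^sup>2 \<le> (cmod (c * w x) + cmod (fourier_series a x))\<^sup>2"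
        by (intro power_mono norm_triangle_ineq) simp
      also have "\<dots> \<le> 2 * (cmod (c * w x))\<^sup>2 + 2 * (cmod (fourier_series a x))\<^sup>2"
        using zero_le_power2[of "cmod (c * w x) - cmod (fourier_series a x)"]
        by (simp add: power2_sum power2_diff)
      finally show ?thesis by (simp add: norm_mult power_mult_distrib)
    qed
    thus "AE x in lebesgue. x \<in> {0..2*pi} \<longrightarrow>
        norm ((cmod (?g x))\<^sup>2) \<le> norm (2 * (cmod c)\<^sup>2 * (cmod (w x))\<^sup>2 + 2 * (cmod (fourier_series a x))\<^sup>2)"
      by (auto intro!: AE_I2 simp: abs_of_nonneg)
  qed
  thus ?thesis using per meas by (simp add: torus_L2_def)
qed

lemma weight_square: "(1 + \<bar>real_of_int k\<bar>) powr (2 * r) * (cmod z)\<^sup>2 = (weight r k * cmod z)\<^sup>2"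
  using powr_power[of "1 + \<bar>real_of_int k\<bar>" r 2]
  by (simp add: weight_def power_mult_distrib mult.commute)

lemma sobolev_norm_alt: "sobolev_norm r f = sqrt (\<Sum>\<^sub>\<infinity>k. (weight r k * cmod (fourier_coeff f k))\<^sup>2)"
  by (simp only: sobolev_norm_def weight_square)

lemma sobolev_alt:
  "f \<in> sobolev r \<longleftrightarrow> f \<in> torus_L2 \<and> (\<lambda>k. (weight r k * cmod (fourier_coeff f k))\<^sup>2) summable_on UNIV"
  by (simp only: sobolev_def weight_square mem_Collect_eq)

lemma sobolev_hs_bounded:
  assumes "f \<in> sobolev r"
  shows "hs_bounded r (fourier_coeff f) (sobolev_norm r f)"
  unfolding hs_bounded_def L2_set_def sobolev_norm_alt
  using assms by (auto simp: sobolev_alt intro!: finite_sum_le_infsum)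

lemma hs_bounded_sum_squares:
  assumes "hs_bounded r a C" "finite F"
  shows "(\<Sum>k\<in>F. (weight r k * cmod (a k))\<^sup>2) \<le> C\<^sup>2"
  using hs_boundedD[OF assms] unfolding L2_set_def
  by (metis hs_bounded_nonneg[OF assms(1)] real_sqrt_le_iff real_sqrt_pow2_iff real_sqrt_unique)

lemma hs_bounded_square_summable:
  assumes "hs_bounded r a C"
  shows "(\<lambda>k. (weight r k * cmod (a k))\<^sup>2) summable_on UNIV"
  using hs_bounded_sum_squares[OF assms] by (intro nonneg_bdd_above_summable_on bdd_aboveI2) auto

lemma hs_bounded_sobolev_norm_le:
  assumes "hs_bounded r (fourier_coeff f) C"
  shows "sobolev_norm r f \<le> C"
  unfolding sobolev_norm_alt
  by (intro real_le_lsqrt hs_bounded_nonneg[OF assms] infsum_le_finite_sums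
      hs_bounded_square_summable[OF assms] hs_bounded_sum_squares[OF assms])

lemma hs_bounded_sobolev:
  assumes "f \<in> torus_L2" "hs_bounded r (fourier_coeff f) C"
  shows "f \<in> sobolev r"
  using assms by (simp add: sobolev_alt hs_bounded_square_summable)

section \<open>One step of the integrator in Fourier space\<close>

definition antideriv :: "(int \<Rightarrow> complex) \<Rightarrow> int \<Rightarrow> complex" where
  "antideriv a k = (if k = 0 then 0 else inverse (\<i> * of_int k)) * a k"

lemma antideriv_abs_summable:
  assumes "abs_summable a"
  shows "abs_summable (antideriv a)"
proof -
  have "cmod (if k = 0 then 0 else inverse (\<i> * of_int k)) \<le> 1" for k :: int
  proof (cases "k = 0")
    case False
    hence "1 \<le> \<bar>k\<bar>" by auto
    hence "1 \<le> \<bar>real_of_int k\<bar>" by linarith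
    thus ?thesis by (simp add: norm_inverse norm_mult inverse_le_1_iff)
  qed auto
  thus ?thesis unfolding antideriv_def by (intro abs_summable_bounded_mult assms)
qed

lemma
  assumes a: "abs_summable a"
  shows twisted_conv_continuous_on: "continuous_on S (\<lambda>s. twisted_conv s a a k)"
    and twisted_conv_integral_has_sum: "((\<lambda>l. LINT s:{p..q}|lebesgue. cis (2 * s * of_int ((k - l) * l)) * (a (k - l) * a l))
          has_sum (LINT s:{p..q}|lebesgue. twisted_conv s a a k)) UNIV"
  unfolding twisted_conv_def
  by (rule infsum_continuous_on[OF _ _ convolution_abs_summable(2)[OF a a, of k]]
           infsum_integral_has_sum[OF _ _ convolution_abs_summable(2)[OF a a, of k]];
      auto intro!: continuous_intros simp: norm_mult)+

text \<open>
  The reason for the form of the scheme. If \<open>n = (k - l) l\<close> is nonzero, integrating the phase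
  \<open>exp (2 i s n)\<close> divides it by \<open>2 i n\<close>, and this factor splits into the symbols of \<open>\<partial>\<^sub>x\<^sup>-\<^sup>1\<close> at
  \<open>k - l\<close> and \<open>l\<close>. The resonant terms \<open>l = 0\<close> and \<open>l = k\<close> have constant phase and contribute
  \<open>\<tau> a\<^sub>0 a\<^sub>k\<close> each to the integral.
\<close>

lemma frozen_integral_term:
  assumes "0 \<le> \<tau>"
  shows "- \<i> * \<mu> * (LINT s:{t..t+\<tau>}|lebesgue. cis (2 * s * of_int ((k - l) * l)) * (a (k - l) * a l))
    = \<mu> / 2 * (cis (2 * (t + \<tau>) * of_int ((k - l) * l)) * (antideriv a (k - l) * antideriv a l)
             - cis (2 * t * of_int ((k - l) * l)) * (antideriv a (k - l) * antideriv a l))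
     + (if l \<in> {0, k} then - \<i> * \<mu> * of_real \<tau> * (a 0 * a k) else 0)"
proof (cases "l \<in> {0, k}")
  case True
  hence "antideriv a (k - l) * antideriv a l = 0" "(k - l) * l = 0" "a (k - l) * a l = a 0 * a k"
    by (auto simp: antideriv_def)
  thus ?thesis using True assms
    by (simp only: if_True) (simp add: set_lebesgue_integral_def scaleR_conv_of_real)
next
  case False
  define \<theta> :: real where "\<theta> = 2 * of_int ((k - l) * l)"
  have \<theta>: "\<theta> \<noteq> 0" using False by (simp add: \<theta>_def)
  have c: "cis (2 * s * of_int ((k - l) * l)) = cis (\<theta> * s)" for s by (simp add: \<theta>_def mult_ac)
  have "antideriv a (k - l) * antideriv a l = - (a (k - l) * a l) * 2 / of_real \<theta>"
    using False by (simp add: antideriv_def \<theta>_def field_simps)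
  hence *: "antideriv a (k - l) * antideriv a l = - 2 * (a (k - l) * a l) / of_real \<theta>" by simp
  have lint: "(LINT s:{t..t+\<tau>}|lebesgue. cis (\<theta> * s) * (a (k - l) * a l))
      = (cis (\<theta> * (t + \<tau>)) - cis (\<theta> * t)) / (\<i> * of_real \<theta>) * (a (k - l) * a l)"
    using assms by (simp only: set_integral_mult_left integral_cis[OF \<theta>] le_add_same_cancel1)
  have "- \<i> * \<mu> * ((E - E') / (\<i> * of_real \<theta>) * X) = \<mu> / 2 * (E * (- 2 * X / of_real \<theta>) - E' * (- 2 * X / of_real \<theta>)) + 0"
    for E E' X
    using \<theta> by (simp add: field_simps)
  thus ?thesis unfolding c lint * using False by (simp only: if_False)
qed

text \<open>
  For \<open>k \<noteq> 0\<close> there are two resonant terms, for \<open>k = 0\<close> they coincide. The correction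
  \<open>i \<mu> \<tau> a\<^sub>0\<^sup>2\<close> at \<open>k = 0\<close> makes up for counting them twice.
\<close>

lemma frozen_integral:
  assumes a: "abs_summable a" and \<tau>: "0 \<le> \<tau>"
  shows "- \<i> * \<mu> * (LINT s:{t..t+\<tau>}|lebesgue. twisted_conv s a a k)
    = - 2 * \<i> * \<mu> * of_real \<tau> * a 0 * a k + (if k = 0 then \<i> * \<mu> * of_real \<tau> * (a 0)\<^sup>2 else 0)
      + \<mu> / 2 * (twisted_conv (t + \<tau>) (antideriv a) (antideriv a) k - twisted_conv t (antideriv a) (antideriv a) k)"
proof -
  note d = antideriv_abs_summable[OF a]
  let ?z = "\<lambda>l. if l \<in> {0, k} then - \<i> * \<mu> * of_real \<tau> * (a 0 * a k) else 0"
  have B: "((\<lambda>l. cis (2 * s * of_int ((k - l) * l)) * (antideriv a (k - l) * antideriv a l)) has_sum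
      twisted_conv s (antideriv a) (antideriv a) k) UNIV" for s
    unfolding twisted_conv_def by (intro has_sum_infsum twisted_conv_summable d)
  have "(?z has_sum (\<Sum>l\<in>{0, k}. ?z l)) UNIV"
    by (rule has_sum_finite_neutralI[of "{0, k}"]) auto
  from has_sum_add[OF has_sum_cmult_right[of _ _ _ "\<mu> / 2", OF has_sum_add[OF B[of "t + \<tau>"] has_sum_cmult_right[of _ _ _ "-1", OF B[of t]]]] this]
  have "((\<lambda>l. - \<i> * \<mu> * (LINT s:{t..t+\<tau>}|lebesgue. cis (2 * s * of_int ((k - l) * l)) * (a (k - l) * a l))) has_sum
     \<mu> / 2 * (twisted_conv (t + \<tau>) (antideriv a) (antideriv a) k - twisted_conv t (antideriv a) (antideriv a) k) + (\<Sum>l\<in>{0, k}. ?z l)) UNIV"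
    by (simp only: frozen_integral_term[OF \<tau>] mult_minus1 add_uminus_conv_diff)
  moreover have "((\<lambda>l. - \<i> * \<mu> * (LINT s:{t..t+\<tau>}|lebesgue. cis (2 * s * of_int ((k - l) * l)) * (a (k - l) * a l))) has_sum
      - \<i> * \<mu> * (LINT s:{t..t+\<tau>}|lebesgue. twisted_conv s a a k)) UNIV"
    by (intro has_sum_cmult_right twisted_conv_integral_has_sum a)
  ultimately have "- \<i> * \<mu> * (LINT s:{t..t+\<tau>}|lebesgue. twisted_conv s a a k) =
     \<mu> / 2 * (twisted_conv (t + \<tau>) (antideriv a) (antideriv a) k - twisted_conv t (antideriv a) (antideriv a) k) + (\<Sum>l\<in>{0, k}. ?z l)"
    using has_sum_unique by blast
  moreover have "(\<Sum>l\<in>{0, k}. ?z l) = - 2 * \<i> * \<mu> * of_real \<tau> * a 0 * a k + (if k = 0 then \<i> * \<mu> * of_real \<tau> * (a 0)\<^sup>2 else 0)"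
    by (cases "k = 0") (simp_all add: power2_eq_square)
  ultimately show ?thesis by (simp only: add.commute)
qed

lemma integrator_step_fourier_series:
  fixes w :: "real \<Rightarrow> complex"
  assumes "abs_summable (fourier_coeff w)"
  defines "a \<equiv> fourier_coeff w"
  shows "integrator_step \<mu> \<tau> t w x = (1 - 2 * \<i> * of_real \<mu> * of_real \<tau> * a 0) * w x
     + fourier_series (\<lambda>k. (if k = 0 then \<i> * of_real \<mu> * of_real \<tau> * (a 0)\<^sup>2 else 0)
         + of_real \<mu> / 2 * (twisted_conv (t + \<tau>) (antideriv a) (antideriv a) k - twisted_conv t (antideriv a) (antideriv a) k)) x"
    (is "_ = _ + fourier_series ?g x")
    and "abs_summable (\<lambda>k. (if k = 0 then \<i> * of_real \<mu> * of_real \<tau> * (a 0)\<^sup>2 else 0)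
         + of_real \<mu> / 2 * (twisted_conv (t + \<tau>) (antideriv a) (antideriv a) k - twisted_conv t (antideriv a) (antideriv a) k))"
proof -
  note d = antideriv_abs_summable[OF assms(1), folded a_def]
  let ?D = "antideriv a"
  let ?d = "\<lambda>k. twisted_conv (t + \<tau>) ?D ?D k - twisted_conv t ?D ?D k"
  let ?u = "\<lambda>k::int. if k = 0 then \<i> * of_real \<mu> * of_real \<tau> * (a 0)\<^sup>2 else 0"
  have D: "inv_deriv w = fourier_series ?D" by (simp add: inv_deriv_fourier_series antideriv_def[abs_def] a_def)
  have cD: "fourier_coeff (inv_deriv w) = ?D" by (rule ext) (simp only: D fourier_coeff_fourier_series[OF d])
  have sD: "abs_summable (fourier_coeff (inv_deriv w))" by (simp only: cD d)
  note sq = free_flow_square_coeff[OF sD, unfolded cD]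
  note b = twisted_conv_abs_summable[OF d d]
  let ?e = "\<lambda>s k. cis (s * (of_int k)\<^sup>2)"
  have e: "abs_summable (\<lambda>k. ?e s k * twisted_conv s' ?D ?D k)" for s s'
    by (intro abs_summable_bounded_mult b) simp
  have inner: "free_flow (- \<tau>) (\<lambda>z. (free_flow (t + \<tau>) (inv_deriv w) z)\<^sup>2)
      = fourier_series (\<lambda>k. ?e (- t) k * twisted_conv (t + \<tau>) ?D ?D k)"
    unfolding free_flow_fourier_series[of "- \<tau>"] sq(2)
    by (simp add: mult.assoc[symmetric] cis_mult ring_distribs)
  have inner': "(\<lambda>y. (free_flow t (inv_deriv w) y)\<^sup>2) = fourier_series (\<lambda>k. ?e (- t) k * twisted_conv t ?D ?D k)"
    by (simp add: sq(1))
  have coeff: "fourier_coeff (\<lambda>y. fourier_series (\<lambda>k. ?e (- t) k * twisted_conv (t + \<tau>) ?D ?D k) y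
      - fourier_series (\<lambda>k. ?e (- t) k * twisted_conv t ?D ?D k) y) k = ?e (- t) k * ?d k" for k
    by (subst fourier_coeff_diff) (simp_all only: fourier_series_integrable e fourier_coeff_fourier_series right_diff_distrib)
  have outer: "free_flow (- t) (\<lambda>y. free_flow (- \<tau>) (\<lambda>z. (free_flow (t + \<tau>) (inv_deriv w) z)\<^sup>2) y
      - (free_flow t (inv_deriv w) y)\<^sup>2) = fourier_series ?d"
    unfolding inner fun_cong[OF inner'] free_flow_fourier_series[of "- t"] coeff
    by (simp add: mult.assoc[symmetric] cis_mult)
  have u: "abs_summable ?u"
    by (rule finite_nonzero_values_imp_summable_on, rule finite_subset[of _ "{0}"]) auto
  have ds: "abs_summable ?d"
    by (rule Infinite_Sum.abs_summable_on_comparison_test'[OF summable_on_add[OF b[of "t + \<tau>"] b[of t]]])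
       (rule norm_triangle_ineq4)
  have ms: "abs_summable (\<lambda>k. of_real \<mu> / 2 * ?d k)"
    unfolding norm_mult by (rule summable_on_cmult_right[OF ds])
  show "abs_summable ?g"
    by (rule Infinite_Sum.abs_summable_on_comparison_test'[OF summable_on_add[OF u ms]]) (rule norm_triangle_ineq)
  have "fourier_series ?g x = (\<Sum>\<^sub>\<infinity>k. ?u k * cis (of_int k * x) + of_real \<mu> / 2 * (?d k * cis (of_int k * x)))"
    unfolding fourier_series_def by (intro infsum_cong) (simp only: ring_distribs mult.assoc)
  also have "\<dots> = fourier_series ?u x + of_real \<mu> / 2 * fourier_series ?d x"
    unfolding fourier_series_def
    by (subst infsum_add) (simp_all only: fourier_series_summable[OF u] summable_on_cmult_right[OF fourier_series_summable[OF ds]] infsum_cmult_right')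
  also have "fourier_series ?u x = \<i> * of_real \<mu> * of_real \<tau> * (a 0)\<^sup>2"
    unfolding fourier_series_def by (rule infsumI, rule has_sum_finite_neutralI[of "{0}"]) auto
  finally show "integrator_step \<mu> \<tau> t w x = (1 - 2 * \<i> * of_real \<mu> * of_real \<tau> * a 0) * w x + fourier_series ?g x"
    unfolding integrator_step_def outer a_def by (simp only: add.assoc)
qed

text \<open>
  A step of the method is the mild equation with the solution frozen at the left end point under
  the integral, where the oscillating phases are integrated exactly.
\<close>

lemma integrator_step_coeff:
  assumes w: "w \<in> torus_L2" and s: "abs_summable (fourier_coeff w)" and \<tau>: "0 \<le> \<tau>"
  shows "integrator_step \<mu> \<tau> t w \<in> torus_L2"
    and "fourier_coeff (integrator_step \<mu> \<tau> t w) k = fourier_coeff w k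
      - \<i> * of_real \<mu> * (LINT s:{t..t+\<tau>}|lebesgue. twisted_conv s (fourier_coeff w) (fourier_coeff w) k)"
proof -
  note step = integrator_step_fourier_series[OF s, of \<mu> \<tau> t]
  note step' = ext[of "integrator_step \<mu> \<tau> t w", OF step(1)]
  show "integrator_step \<mu> \<tau> t w \<in> torus_L2"
    unfolding step' by (rule torus_L2_affine_combination[OF w step(2)])
  show "fourier_coeff (integrator_step \<mu> \<tau> t w) k = fourier_coeff w k
      - \<i> * of_real \<mu> * (LINT s:{t..t+\<tau>}|lebesgue. twisted_conv s (fourier_coeff w) (fourier_coeff w) k)"
    unfolding step' fourier_coeff_add[OF set_integrable_mult_right[OF torus_L2_integrable[OF w]] fourier_series_integrable[OF step(2)]]
      fourier_coeff_cmult fourier_coeff_fourier_series[OF step(2)]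
    using frozen_integral[OF s \<tau>, of "of_real \<mu>" t k] by (simp add: algebra_simps)
qed

section \<open>The mild equation in Fourier space\<close>

lemma sigma_finite_lebesgue: "sigma_finite_measure (lebesgue :: real measure)"
proof
  let ?A = "range (\<lambda>n::nat. {- real n..real n})"
  have "\<exists>n. x \<in> {- real n..real n}" for x
    using real_arch_simple[of "\<bar>x\<bar>"] by (auto simp: abs_le_iff minus_le_iff)
  hence "\<Union> ?A = space lebesgue" by auto
  thus "\<exists>A::real set set. countable A \<and> A \<subseteq> sets lebesgue \<and> \<Union> A = space lebesgue \<and> (\<forall>a\<in>A. emeasure lebesgue a \<noteq> \<infinity>)"
    by (intro exI[of _ ?A]) auto
qed

interpretation lebesgue_pair: pair_sigma_finite "lebesgue :: real measure" "lebesgue :: real measure"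
  by (intro pair_sigma_finite.intro sigma_finite_lebesgue)

text \<open>
  Joint measurability of a function that is measurable in the first and continuous in the second
  argument: rounding \<open>x\<close> down to a multiple of \<open>1 / (m + 1)\<close> gives countable combinations of
  sections, and they converge by continuity.
\<close>

lemma caratheodory_measurable:
  fixes H :: "'a \<Rightarrow> real \<Rightarrow> complex"
  assumes meas: "\<And>x. (\<lambda>s. H s x) \<in> borel_measurable M" and cont: "\<And>s. continuous_on UNIV (H s)"
  shows "(\<lambda>(s, x). H s x) \<in> borel_measurable (M \<Otimes>\<^sub>M lebesgue)"
proof (rule borel_measurable_LIMSEQ_metric)
  let ?g = "\<lambda>m x. real_of_int \<lfloor>x * real (Suc m)\<rfloor> / real (Suc m)"
  show "(\<lambda>(s, x). H s (?g m x)) \<in> borel_measurable (M \<Otimes>\<^sub>M lebesgue)" for m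
  proof -
    have "(\<lambda>p. H (fst p) (real_of_int i / real (Suc m))) \<in> borel_measurable (M \<Otimes>\<^sub>M lebesgue)" for i
      by (rule measurable_compose[OF measurable_fst meas])
    moreover have "(\<lambda>x. \<lfloor>x * real (Suc m)\<rfloor>) \<in> lebesgue \<rightarrow>\<^sub>M count_space UNIV"
      by (intro measurable_completion) measurable
    hence "(\<lambda>p. \<lfloor>snd p * real (Suc m)\<rfloor>) \<in> M \<Otimes>\<^sub>M lebesgue \<rightarrow>\<^sub>M count_space UNIV"
      by (rule measurable_compose[OF measurable_snd])
    ultimately show ?thesis
      unfolding case_prod_unfold by (rule measurable_compose_countable)
  qed
  show "(\<lambda>m. case p of (s, x) \<Rightarrow> H s (?g m x)) \<longlonglongrightarrow> (case p of (s, x) \<Rightarrow> H s x)" for p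
  proof (cases p)
    case (Pair s x)
    have "(\<lambda>m. ?g m x) \<longlonglongrightarrow> x"
    proof (rule real_tendsto_sandwich)
      show "\<forall>\<^sub>F m in sequentially. x - inverse (real (Suc m)) \<le> ?g m x"
      proof (intro always_eventually allI)
        fix m
        have "x * real (Suc m) - 1 \<le> real_of_int \<lfloor>x * real (Suc m)\<rfloor>" by linarith
        hence "(x * real (Suc m) - 1) / real (Suc m) \<le> ?g m x" by (intro divide_right_mono) auto
        thus "x - inverse (real (Suc m)) \<le> ?g m x" by (simp add: diff_divide_distrib inverse_eq_divide)
      qed
      show "\<forall>\<^sub>F m in sequentially. ?g m x \<le> x"
      proof (intro always_eventually allI)
        fix m
        have "?g m x \<le> x * real (Suc m) / real (Suc m)" by (intro divide_right_mono of_int_floor_le) auto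
        thus "?g m x \<le> x" by simp
      qed
      show "(\<lambda>m. x - inverse (real (Suc m))) \<longlonglongrightarrow> x"
        using tendsto_diff[OF tendsto_const LIMSEQ_inverse_real_of_nat, of x] by simp
    qed simp
    moreover have "isCont (H s) x" using cont[of s] by (simp add: continuous_on_eq_continuous_at)
    ultimately show ?thesis unfolding Pair prod.case by (rule isCont_tendsto_compose[rotated])
  qed
qed

text \<open>
  Fubini's theorem for the time integral and the integral that defines a Fourier coefficient. Only
  separate measurability in time is known for the mild integrand; continuity in space upgrades it.
\<close>

lemma
  fixes G :: "real \<Rightarrow> real \<Rightarrow> complex"
  assumes int: "\<And>x. set_integrable lebesgue {0..t} (\<lambda>s. G s x)"
    and cont: "\<And>s. s \<in> {0..t} \<Longrightarrow> continuous_on UNIV (G s)"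
    and bd: "\<And>s x. s \<in> {0..t} \<Longrightarrow> cmod (G s x) \<le> C"
  shows fourier_coeff_time_integrable: "set_integrable lebesgue {0..t} (\<lambda>s. fourier_coeff (G s) k)"
    and time_integral_integrable: "set_integrable lebesgue {0..2*pi} (\<lambda>x. LINT s:{0..t}|lebesgue. G s x)"
    and fourier_coeff_time_integral:
      "fourier_coeff (\<lambda>x. LINT s:{0..t}|lebesgue. G s x) k = (LINT s:{0..t}|lebesgue. fourier_coeff (G s) k)"
proof -
  define H where "H s x = indicator {0..t} s *\<^sub>R G s x" for s x
  define J where "J j s x = indicator {0..2*pi} x *\<^sub>R (H s x * cis (- of_int j * x))" for j :: int and s x
  let ?L = "lebesgue :: real measure"
  have H: "(\<lambda>(s, x). H s x) \<in> borel_measurable (?L \<Otimes>\<^sub>M ?L)"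
  proof (rule caratheodory_measurable)
    show "(\<lambda>s. H s x) \<in> borel_measurable lebesgue" for x
      using int[of x] unfolding H_def set_integrable_def by (rule borel_measurable_integrable)
    show "continuous_on UNIV (H s)" for s
      unfolding H_def by (cases "s \<in> {0..t}") (use cont in auto)
  qed
  have Jint: "integrable (?L \<Otimes>\<^sub>M ?L) (\<lambda>(s, x). J j s x)" for j
  proof (rule Bochner_Integration.integrable_bound)
    have "emeasure (?L \<Otimes>\<^sub>M ?L) ({0..t} \<times> {0..2*pi}) = emeasure ?L {0..t} * emeasure ?L {0..2*pi}"
      by (intro sigma_finite_measure.emeasure_pair_measure_Times sigma_finite_lebesgue) auto
    hence "emeasure (?L \<Otimes>\<^sub>M ?L) ({0..t} \<times> {0..2*pi}) < \<infinity>"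
      by (simp add: ennreal_mult_less_top emeasure_lborel_Icc_eq)
    thus "integrable (?L \<Otimes>\<^sub>M ?L) (\<lambda>p. C * indicator ({0..t} \<times> {0..2*pi}) p)"
      by (intro integrable_mult_right integrable_real_indicator) auto
    have c: "(\<lambda>x. indicator {0..2*pi} x *\<^sub>R cis (- of_int j * x)) \<in> borel_measurable ?L"
      by (intro borel_measurable_scaleR borel_measurable_indicator measurable_completion[of "\<lambda>x. cis (- of_int j * x)"])
         (auto intro!: borel_measurable_continuous_onI continuous_intros)
    have "(\<lambda>p. (case p of (s, x) \<Rightarrow> H s x) * (indicator {0..2*pi} (snd p) *\<^sub>R cis (- of_int j * snd p)))
        \<in> borel_measurable (?L \<Otimes>\<^sub>M ?L)"
      by (intro borel_measurable_times H measurable_compose[OF measurable_snd c])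
    thus "(\<lambda>(s, x). J j s x) \<in> borel_measurable (?L \<Otimes>\<^sub>M ?L)"
      by (simp add: J_def case_prod_unfold)
    have "norm (J j s x) \<le> norm (C * indicator ({0..t} \<times> {0..2*pi}) (s, x))" for s x
    proof (cases "s \<in> {0..t} \<and> x \<in> {0..2*pi}")
      case True
      hence "norm (J j s x) = cmod (G s x)" by (simp add: J_def H_def norm_mult)
      also have "\<dots> \<le> \<bar>C\<bar>" using bd[of s x] True by linarith
      finally show ?thesis using True by simp
    next
      case False
      hence "J j s x = 0" by (auto simp: J_def H_def)
      thus ?thesis by simp
    qed
    thus "AE p in ?L \<Otimes>\<^sub>M ?L. norm (case p of (s, x) \<Rightarrow> J j s x) \<le> norm (C * indicator ({0..t} \<times> {0..2*pi}) p)"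
      by (auto intro!: AE_I2 simp del: norm_mult)
  qed
  have s: "(\<integral>x. J j s x \<partial>lebesgue) = indicator {0..t} s *\<^sub>R (LINT x:{0..2*pi}|lebesgue. G s x * cis (- of_int j * x))" for j s
    by (simp add: J_def H_def set_lebesgue_integral_def indicator_def)
  have x: "(\<integral>s. J j s x \<partial>lebesgue) = indicator {0..2*pi} x *\<^sub>R ((LINT s:{0..t}|lebesgue. G s x) * cis (- of_int j * x))" for j x
    by (simp only: J_def H_def set_lebesgue_integral_def integral_scaleR_right integral_mult_left_zero)
  have "integrable lebesgue (\<lambda>s. indicator {0..t} s *\<^sub>R (LINT x:{0..2*pi}|lebesgue. G s x * cis (- of_int k * x)))"
    using lebesgue_pair.integrable_fst[OF Jint[of k]] by (simp only: s)
  hence "set_integrable lebesgue {0..t} (\<lambda>s. (LINT x:{0..2*pi}|lebesgue. G s x * cis (- of_int k * x)))"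
    by (simp only: set_integrable_def)
  thus "set_integrable lebesgue {0..t} (\<lambda>s. fourier_coeff (G s) k)"
    unfolding fourier_coeff_alt by (rule set_integrable_divide)
  \<comment> \<open>For \<open>j = 0\<close> the character is constant.\<close>
  show "set_integrable lebesgue {0..2*pi} (\<lambda>x. LINT s:{0..t}|lebesgue. G s x)"
    using lebesgue_pair.integrable_snd[OF Jint[of 0]] unfolding x by (simp add: set_integrable_def)
  have "(LINT x:{0..2*pi}|lebesgue. (LINT s:{0..t}|lebesgue. G s x) * cis (- of_int k * x))
      = (LINT s:{0..t}|lebesgue. LINT x:{0..2*pi}|lebesgue. G s x * cis (- of_int k * x))"
    using lebesgue_pair.Fubini_integral[OF Jint[of k]] unfolding x s
    by (simp only: set_lebesgue_integral_def)
  thus "fourier_coeff (\<lambda>x. LINT s:{0..t}|lebesgue. G s x) k = (LINT s:{0..t}|lebesgue. fourier_coeff (G s) k)"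
    unfolding fourier_coeff_alt by (simp only: set_integral_divide_zero)
qed

lemma fourier_coeff_cong_AE:
  assumes f: "set_integrable lebesgue {0..2*pi} f" and g: "set_integrable lebesgue {0..2*pi} g"
    and ae: "AE x in lebesgue. f x = g x"
  shows "fourier_coeff f k = fourier_coeff g k"
proof -
  have "(LINT x:{0..2*pi}|lebesgue. f x * cis (- of_int k * x)) = (LINT x:{0..2*pi}|lebesgue. g x * cis (- of_int k * x))"
    unfolding set_lebesgue_integral_def
    using set_integrable_times_character[OF f, of "- of_int k"] set_integrable_times_character[OF g, of "- of_int k"] ae
    by (intro integral_cong_AE) (auto simp: set_integrable_def dest: borel_measurable_integrable)
  thus ?thesis by (simp only: fourier_coeff_alt)
qed

text \<open>
  The integrand is bounded, uniformly in time and space, by the norm of its coefficients in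
  \<open>\<ell>\<^sup>1\<close>, hence by a multiple of \<open>M\<^sup>2\<close>. Fubini's theorem then turns the pointwise mild equation into
  one equation for each coefficient.
\<close>

lemma mild_solution_coeff:
  fixes v :: "real \<Rightarrow> real \<Rightarrow> complex"
  assumes r: "r > 1/2" and mild: "mild_solution \<mu> T v"
    and L2: "\<And>t. t \<in> {0..T} \<Longrightarrow> v t \<in> torus_L2"
    and M: "\<And>t. t \<in> {0..T} \<Longrightarrow> hs_bounded r (fourier_coeff (v t)) M"
    and t: "t \<in> {0..T}"
  defines "V \<equiv> \<lambda>s. fourier_coeff (v s)"
  shows "set_integrable lebesgue {0..t} (\<lambda>s. twisted_conv s (V s) (V s) k)"
    and "V t k = V 0 k - \<i> * of_real \<mu> * (LINT s:{0..t}|lebesgue. twisted_conv s (V s) (V s) k)"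
proof -
  let ?G = "\<lambda>s. twisted_square s (v s)"
  have sub: "s \<in> {0..T}" if "s \<in> {0..t}" for s using that t by auto
  have G: "?G s = fourier_series (twisted_conv s (V s) (V s))" "abs_summable (twisted_conv s (V s) (V s))"
    "(\<Sum>\<^sub>\<infinity>k. cmod (twisted_conv s (V s) (V s) k)) \<le> embed_const r * (algebra_const r * M * M)" if "s \<in> {0..t}" for s
    using hs_bounded_abs_summable[OF r hs_bounded_twisted_conv[OF r M M], OF sub[OF that] sub[OF that]]
      twisted_square_fourier_series[OF hs_bounded_abs_summable(1)[OF r M], OF sub[OF that]]
    by (simp_all add: V_def)
  have int: "set_integrable lebesgue {0..t} (\<lambda>s. ?G s x)" for x
    using mild t by (auto simp: mild_solution_def)
  have cont: "continuous_on UNIV (?G s)" if "s \<in> {0..t}" for s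
    using G(1,2)[OF that] by (simp add: fourier_series_continuous)
  have bd: "cmod (?G s x) \<le> embed_const r * (algebra_const r * M * M)" if "s \<in> {0..t}" for s x
    using order_trans[OF fourier_series_norm_le[OF G(2)[OF that]] G(3)[OF that]] by (simp only: G(1)[OF that])
  have coeff: "fourier_coeff (?G s) k = twisted_conv s (V s) (V s) k" if "s \<in> {0..t}" for s k
    using G(1,2)[OF that] by (simp add: fourier_coeff_fourier_series)
  note fub = fourier_coeff_time_integrable[OF int cont bd] time_integral_integrable[OF int cont bd]
    fourier_coeff_time_integral[OF int cont bd]
  show "set_integrable lebesgue {0..t} (\<lambda>s. twisted_conv s (V s) (V s) k)"
    using iffD1[OF set_integrable_cong[OF refl refl coeff] fub(1)] .
  have i0: "set_integrable lebesgue {0..2*pi} (v 0)" and it: "set_integrable lebesgue {0..2*pi} (v t)"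
    using t by (auto intro!: torus_L2_integrable L2)
  have im: "set_integrable lebesgue {0..2*pi} (\<lambda>x. \<i> * of_real \<mu> * (LINT s:{0..t}|lebesgue. ?G s x))"
    by (intro set_integrable_mult_right fub(2))
  have "V t k = fourier_coeff (\<lambda>x. v 0 x - \<i> * of_real \<mu> * (LINT s:{0..t}|lebesgue. ?G s x)) k"
    unfolding V_def
    by (rule fourier_coeff_cong_AE[OF it set_integral_diff(1)[OF i0 im]])
       (use mild t in \<open>auto simp: mild_solution_def\<close>)
  also have "\<dots> = V 0 k - \<i> * of_real \<mu> * (LINT s:{0..t}|lebesgue. fourier_coeff (?G s) k)"
    by (simp only: fourier_coeff_diff[OF i0 im] fourier_coeff_cmult fub(3) V_def)
  also have "(LINT s:{0..t}|lebesgue. fourier_coeff (?G s) k) = (LINT s:{0..t}|lebesgue. twisted_conv s (V s) (V s) k)"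
    by (rule set_lebesgue_integral_cong) (auto simp: coeff)
  finally show "V t k = V 0 k - \<i> * of_real \<mu> * (LINT s:{0..t}|lebesgue. twisted_conv s (V s) (V s) k)" .
qed

lemma set_integral_combine:
  fixes f :: "real \<Rightarrow> complex"
  assumes "0 \<le> p" "p \<le> q" "set_integrable lebesgue {0..q} f"
  shows "set_integrable lebesgue {p..q} f"
    and "(LINT s:{0..q}|lebesgue. f s) = (LINT s:{0..p}|lebesgue. f s) + (LINT s:{p..q}|lebesgue. f s)"
proof -
  have "set_integrable lebesgue {0..p} f"
    using assms by (intro set_integrable_subset[OF assms(3)]) auto
  moreover show "set_integrable lebesgue {p..q} f"
    using assms by (intro set_integrable_subset[OF assms(3)]) auto
  ultimately show "(LINT s:{0..q}|lebesgue. f s) = (LINT s:{0..p}|lebesgue. f s) + (LINT s:{p..q}|lebesgue. f s)"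
    using assms Henstock_Kurzweil_Integration.integral_combine[OF assms(1,2) set_lebesgue_integral_eq_integral(1)[OF assms(3)]]
    by (simp add: set_lebesgue_integral_eq_integral(2))
qed

section \<open>Convergence\<close>

text \<open>
  The mild equation is stated between two arbitrary times because the error analysis restarts it
  at every time step.
\<close>

definition coeff_solution :: "real \<Rightarrow> real \<Rightarrow> (real \<Rightarrow> int \<Rightarrow> complex) \<Rightarrow> bool" where
  "coeff_solution \<mu> T V \<longleftrightarrow> (\<forall>p q k. 0 \<le> p \<longrightarrow> p \<le> q \<longrightarrow> q \<le> T \<longrightarrow>
     set_integrable lebesgue {p..q} (\<lambda>s. twisted_conv s (V s) (V s) k) \<and>
     V q k - V p k = - \<i> * of_real \<mu> * (LINT s:{p..q}|lebesgue. twisted_conv s (V s) (V s) k))"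

lemma mild_solution_coeff_solution:
  assumes r: "r > 1/2" and mild: "mild_solution \<mu> T v"
    and L2: "\<And>t. t \<in> {0..T} \<Longrightarrow> v t \<in> torus_L2"
    and M: "\<And>t. t \<in> {0..T} \<Longrightarrow> hs_bounded r (fourier_coeff (v t)) M"
  shows "coeff_solution \<mu> T (\<lambda>t. fourier_coeff (v t))"
  unfolding coeff_solution_def
proof (intro allI impI)
  fix p q k assume pq: "0 \<le> p" "p \<le> q" "q \<le> T"
  have q: "q \<in> {0..T}" and p: "p \<in> {0..T}" using pq by auto
  let ?B = "\<lambda>s. twisted_conv s (fourier_coeff (v s)) (fourier_coeff (v s)) k"
  have "set_integrable lebesgue {0..q} ?B" by (rule mild_solution_coeff(1)[OF r mild L2 M q])
  note split = set_integral_combine[OF pq(1,2) this]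
  have eq: "fourier_coeff (v q) k = fourier_coeff (v 0) k - \<i> * of_real \<mu> * (LINT s:{0..q}|lebesgue. ?B s)"
    "fourier_coeff (v p) k = fourier_coeff (v 0) k - \<i> * of_real \<mu> * (LINT s:{0..p}|lebesgue. ?B s)"
    by (rule mild_solution_coeff(2)[OF r mild L2 M q] mild_solution_coeff(2)[OF r mild L2 M p]; assumption)+
  show "set_integrable lebesgue {p..q} (\<lambda>s. twisted_conv s (fourier_coeff (v s)) (fourier_coeff (v s)) k) \<and>
     fourier_coeff (v q) k - fourier_coeff (v p) k
       = - \<i> * of_real \<mu> * (LINT s:{p..q}|lebesgue. twisted_conv s (fourier_coeff (v s)) (fourier_coeff (v s)) k)"
    using split(1) unfolding eq split(2) by (simp add: ring_distribs)
qed

lemma hs_bounded_diff: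
  "hs_bounded r a C \<Longrightarrow> hs_bounded r b D \<Longrightarrow> hs_bounded r (\<lambda>k. a k - b k) (C + D)"
  using hs_bounded_add[OF _ hs_bounded_minus, of r a C b D] by simp

text \<open>
  Bounded solutions are Lipschitz continuous in time with values in \<open>H\<^sup>r\<close>. No derivative is lost
  here: the twisted product is bounded on \<open>H\<^sup>r\<close>, and this is why the method converges with order
  one without additional regularity.
\<close>

lemma coeff_solution_lipschitz:
  assumes r: "r > 1/2" and V: "coeff_solution \<mu> T V"
    and M: "\<And>t. t \<in> {0..T} \<Longrightarrow> hs_bounded r (V t) M" and pq: "0 \<le> p" "p \<le> q" "q \<le> T"
  shows "hs_bounded r (\<lambda>k. V q k - V p k) (\<bar>\<mu>\<bar> * ((q - p) * (algebra_const r * M * M)))"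
proof -
  have "hs_bounded r (\<lambda>k. - \<i> * of_real \<mu> * (LINT s:{p..q}|lebesgue. twisted_conv s (V s) (V s) k))
      (cmod (- \<i> * of_real \<mu>) * ((q - p) * (algebra_const r * M * M)))"
    using V pq by (intro hs_bounded_cmult hs_bounded_integral hs_bounded_twisted_conv r M) (auto simp: coeff_solution_def)
  thus ?thesis using V pq by (simp add: coeff_solution_def norm_mult)
qed

text \<open>
  Consistency and stability in one estimate. On \<open>[p, q]\<close> the solution differs from the frozen
  value \<open>a\<close> by at most the Lipschitz bound plus the error \<open>E\<close> at time \<open>p\<close>. The integrands then
  differ by at most a constant times this amount, and integration gains a factor \<open>q - p\<close>.
\<close>

lemma one_step_error:
  assumes r: "r > 1/2" and V: "coeff_solution \<mu> T V"
    and M: "\<And>t. t \<in> {0..T} \<Longrightarrow> hs_bounded r (V t) M" and pq: "0 \<le> p" "p \<le> q" "q \<le> T"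
    and a: "hs_bounded r a (M + 1)" and E: "hs_bounded r (\<lambda>k. V p k - a k) E"
  shows "hs_bounded r (\<lambda>k. V q k - (a k - \<i> * of_real \<mu> * (LINT s:{p..q}|lebesgue. twisted_conv s a a k)))
     (E + \<bar>\<mu>\<bar> * ((q - p) * (algebra_const r * (2 * M + 1) * (\<bar>\<mu>\<bar> * ((q - p) * (algebra_const r * M * M)) + E))))"
proof -
  let ?K = "algebra_const r"
  let ?D = "\<bar>\<mu>\<bar> * ((q - p) * (?K * M * M)) + E"
  have M0: "0 \<le> M" using hs_bounded_nonneg[OF M[of p]] pq by simp
  note sa = hs_bounded_abs_summable(1)[OF r a]
  have iV: "set_integrable lebesgue {p..q} (\<lambda>s. twisted_conv s (V s) (V s) k)" for k
    using V pq by (auto simp: coeff_solution_def)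
  have ia: "set_integrable lebesgue {p..q} (\<lambda>s. twisted_conv s a a k)" for k
    by (intro absolutely_integrable_continuous_real twisted_conv_continuous_on sa)
  have "hs_bounded r (\<lambda>k. twisted_conv s (V s) (V s) k - twisted_conv s a a k) (?K * (2 * M + 1) * ?D)" if s: "s \<in> {p..q}" for s
  proof -
    have sT: "s \<in> {0..T}" using s pq by auto
    note Vs = M[OF sT]
    have "hs_bounded r (\<lambda>k. (V s k - V p k) + (V p k - a k)) (\<bar>\<mu>\<bar> * ((s - p) * (?K * M * M)) + E)"
      using s pq by (intro hs_bounded_add E coeff_solution_lipschitz[OF r V M]) auto
    hence 1: "hs_bounded r (\<lambda>k. V s k - a k) (\<bar>\<mu>\<bar> * ((s - p) * (?K * M * M)) + E)" by simp
    have "0 \<le> ?K * M * M" by (intro mult_nonneg_nonneg M0 algebra_const_nonneg)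
    hence "(s - p) * (?K * M * M) \<le> (q - p) * (?K * M * M)" using s by (intro mult_right_mono) auto
    hence "\<bar>\<mu>\<bar> * ((s - p) * (?K * M * M)) + E \<le> ?D" by (intro add_right_mono mult_left_mono) auto
    with 1 have d: "hs_bounded r (\<lambda>k. V s k - a k) ?D" by (rule hs_bounded_mono)
    have "hs_bounded r (\<lambda>k. twisted_conv s (\<lambda>k. V s k - a k) (V s) k + twisted_conv s a (\<lambda>k. V s k - a k) k)
        (?K * ?D * M + ?K * (M + 1) * ?D)"
      by (intro hs_bounded_add hs_bounded_twisted_conv r d Vs a)
    thus ?thesis
      by (simp add: twisted_conv_square_diff[OF hs_bounded_abs_summable(1)[OF r Vs] sa] algebra_simps)
  qed
  hence bound: "hs_bounded r (\<lambda>k. (V p k - a k) + - \<i> * of_real \<mu> * (LINT s:{p..q}|lebesgue. twisted_conv s (V s) (V s) k - twisted_conv s a a k))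
     (E + cmod (- \<i> * of_real \<mu>) * ((q - p) * (?K * (2 * M + 1) * ?D)))"
    by (intro hs_bounded_add E hs_bounded_cmult hs_bounded_integral pq set_integral_diff(1) iV ia)
  have eq: "(V p k - a k) + - \<i> * of_real \<mu> * (LINT s:{p..q}|lebesgue. twisted_conv s (V s) (V s) k - twisted_conv s a a k)
      = V q k - (a k - \<i> * of_real \<mu> * (LINT s:{p..q}|lebesgue. twisted_conv s a a k))" for k
  proof -
    have "V q k - V p k = - \<i> * of_real \<mu> * (LINT s:{p..q}|lebesgue. twisted_conv s (V s) (V s) k)"
      using V pq by (simp add: coeff_solution_def)
    thus ?thesis unfolding set_integral_diff(2)[OF iV ia] by (simp add: algebra_simps)
  qed
  show ?thesis using bound unfolding eq by (simp only: norm_mult norm_minus_cancel norm_ii norm_of_real mult_1 real_norm_def)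
qed

definition growth_rate :: "real \<Rightarrow> real \<Rightarrow> real \<Rightarrow> real" where
  "growth_rate r \<mu> M = \<bar>\<mu>\<bar> * (algebra_const r * (2 * M + 1))"

definition local_error_const :: "real \<Rightarrow> real \<Rightarrow> real \<Rightarrow> real" where
  "local_error_const r \<mu> M = growth_rate r \<mu> M * (\<bar>\<mu>\<bar> * (algebra_const r * M * M))"

definition error_const :: "real \<Rightarrow> real \<Rightarrow> real \<Rightarrow> real \<Rightarrow> real" where
  "error_const r \<mu> T M = T * local_error_const r \<mu> M * exp (growth_rate r \<mu> M * T)"

text \<open>
  The recursion \<open>e\<^sub>n\<^sub>+\<^sub>1 \<le> (1 + g \<tau>) e\<^sub>n + L \<tau>\<^sup>2\<close> is majorized by
  \<open>n L \<tau>\<^sup>2 (1 + g \<tau>)\<^sup>n\<close>. Unlike the sharper geometric sum, this involves no division by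
  \<open>g\<close>, which vanishes for \<open>\<mu> = 0\<close>.
\<close>

lemma error_accumulation:
  fixes L g \<tau> T :: real
  assumes "0 \<le> L" "0 \<le> g" "0 \<le> \<tau>" "real n * \<tau> \<le> T"
  shows "real n * (L * \<tau>\<^sup>2) * (1 + g * \<tau>) ^ n \<le> T * L * exp (g * T) * \<tau>"
proof -
  have "(1 + g * \<tau>) ^ n \<le> exp (g * \<tau>) ^ n"
    using assms by (intro power_mono) (auto intro: exp_ge_add_one_self)
  also have "\<dots> = exp (g * (real n * \<tau>))" by (simp add: exp_of_nat_mult[symmetric] mult_ac)
  also have "\<dots> \<le> exp (g * T)" using assms by (auto intro: mult_left_mono)
  finally have *: "(1 + g * \<tau>) ^ n \<le> exp (g * T)" .
  have "0 \<le> real n * \<tau>" using assms by simp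
  hence "0 \<le> T" using assms(4) by (rule order_trans)
  with * have "(real n * \<tau>) * (L * \<tau> * (1 + g * \<tau>) ^ n) \<le> T * (L * \<tau> * exp (g * T))"
    using assms by (intro mult_mono mult_left_mono) auto
  thus ?thesis by (simp add: power2_eq_square mult_ac)
qed

lemma error_recursion:
  fixes L g \<tau> :: real
  assumes "0 \<le> L" "0 \<le> g" "0 \<le> \<tau>"
  defines "E \<equiv> \<lambda>n. real n * (L * \<tau>\<^sup>2) * (1 + g * \<tau>) ^ n"
  shows "E n * (1 + g * \<tau>) + L * \<tau>\<^sup>2 \<le> E (Suc n)"
proof -
  have "L * \<tau>\<^sup>2 * 1 \<le> L * \<tau>\<^sup>2 * (1 + g * \<tau>) ^ Suc n"
    using assms by (intro mult_left_mono one_le_power) auto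
  thus ?thesis by (simp add: E_def algebra_simps)
qed

text \<open>
  Discrete Gronwall argument. The restriction on \<open>\<tau>\<close> keeps the accumulated error below one, so the
  iterates stay in the ball of radius \<open>M + 1\<close>, where the one-step estimate holds with constants
  that depend on \<open>M\<close> only.
\<close>

lemma integrator_error:
  assumes r: "r > 1/2" and V: "coeff_solution \<mu> T (\<lambda>t. fourier_coeff (v t))"
    and L2: "v 0 \<in> torus_L2"
    and M: "\<And>t. t \<in> {0..T} \<Longrightarrow> hs_bounded r (fourier_coeff (v t)) M"
    and \<tau>: "0 < \<tau>" "error_const r \<mu> T M * \<tau> \<le> 1" and n: "real n * \<tau> \<le> T"
  defines "E \<equiv> \<lambda>n. real n * (local_error_const r \<mu> M * \<tau>\<^sup>2) * (1 + growth_rate r \<mu> M * \<tau>) ^ n"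
  shows "integrator \<mu> \<tau> (v 0) n \<in> torus_L2 \<and>
    hs_bounded r (\<lambda>k. fourier_coeff (v (real n * \<tau>)) k - fourier_coeff (integrator \<mu> \<tau> (v 0) n) k) (E n)"
  using n
proof (induction n)
  case 0
  show ?case using L2 by (simp add: E_def hs_bounded_def L2_set_def)
next
  case (Suc n)
  let ?t = "real n * \<tau>" and ?w = "integrator \<mu> \<tau> (v 0) n"
  let ?g = "growth_rate r \<mu> M" and ?L = "local_error_const r \<mu> M" and ?K = "algebra_const r"
  have t: "0 \<le> ?t" "?t \<le> ?t + \<tau>" "?t + \<tau> \<le> T" using Suc.prems \<tau> by (auto simp: algebra_simps)
  have tT: "?t \<in> {0..T}" using t by simp
  have M0: "0 \<le> M" using hs_bounded_nonneg[OF M[OF tT]] .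
  have nonneg: "0 \<le> ?g" "0 \<le> ?L"
    using M0 algebra_const_nonneg[of r] by (simp_all add: growth_rate_def local_error_const_def)
  have IH: "?w \<in> torus_L2" "hs_bounded r (\<lambda>k. fourier_coeff (v ?t) k - fourier_coeff ?w k) (E n)"
    using Suc.IH tT by auto
  have "E n \<le> error_const r \<mu> T M * \<tau>"
    using error_accumulation[OF nonneg(2,1), of \<tau> n T] tT \<tau> by (simp add: E_def error_const_def)
  hence E1: "E n \<le> 1" using \<tau> by simp
  have w: "hs_bounded r (fourier_coeff ?w) (M + 1)"
    using hs_bounded_diff[OF M[OF tT] hs_bounded_mono[OF IH(2) E1]] by simp
  note s = hs_bounded_abs_summable(1)[OF r w]
  note step = integrator_step_coeff[OF IH(1) s, of \<tau> \<mu> ?t]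
  have st: "real (Suc n) * \<tau> = ?t + \<tau>" by (simp add: algebra_simps)
  have "E n + \<bar>\<mu>\<bar> * ((?t + \<tau> - ?t) * (?K * (2 * M + 1) * (\<bar>\<mu>\<bar> * ((?t + \<tau> - ?t) * (?K * M * M)) + E n)))
      = E n * (1 + ?g * \<tau>) + ?L * \<tau>\<^sup>2"
    by (simp add: growth_rate_def local_error_const_def power2_eq_square algebra_simps)
  also have "\<dots> \<le> E (Suc n)"
    unfolding E_def using \<tau> by (intro error_recursion nonneg) auto
  finally have "hs_bounded r (\<lambda>k. fourier_coeff (v (?t + \<tau>)) k - (fourier_coeff ?w k
      - \<i> * of_real \<mu> * (LINT s:{?t..?t+\<tau>}|lebesgue. twisted_conv s (fourier_coeff ?w) (fourier_coeff ?w) k))) (E (Suc n))"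
    by (rule hs_bounded_mono[OF one_step_error[OF r V M t w IH(2)], rotated])
  thus ?case using step \<tau> by (simp only: st integrator.simps order_less_imp_le simp_thms)
qed

theorem theorem3p3:
  fixes \<mu> T r :: real
  assumes "T > 0" and "r > 1/2"
  shows "\<exists>c :: real \<Rightarrow> real. \<forall>v :: real \<Rightarrow> real \<Rightarrow> complex.
    (\<forall>t\<in>{0..T}. v t \<in> sobolev r) \<longrightarrow>
    bdd_above ((\<lambda>t. sobolev_norm r (v t)) ` {0..T}) \<longrightarrow>
    mild_solution \<mu> T v \<longrightarrow>
    (\<exists>\<tau>\<^sub>0>0. \<forall>\<tau>. 0 < \<tau> \<and> \<tau> \<le> \<tau>\<^sub>0 \<longrightarrow>
      (\<forall>n::nat. real n * \<tau> \<le> T \<longrightarrow>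
        integrator \<mu> \<tau> (v 0) n \<in> sobolev r \<and>
        sobolev_norm r (\<lambda>x. v (real n * \<tau>) x - integrator \<mu> \<tau> (v 0) n x)
          \<le> c (SUP t\<in>{0..T}. sobolev_norm r (v t)) * \<tau>))"
proof (intro exI[of _ "error_const r \<mu> T"] allI impI)
  fix v :: "real \<Rightarrow> real \<Rightarrow> complex"
  assume sob: "\<forall>t\<in>{0..T}. v t \<in> sobolev r"
    and bdd: "bdd_above ((\<lambda>t. sobolev_norm r (v t)) ` {0..T})" and mild: "mild_solution \<mu> T v"
  define M where "M = (SUP t\<in>{0..T}. sobolev_norm r (v t))"
  let ?c = "error_const r \<mu> T M" and ?I = "integrator \<mu>"
  have L2: "v t \<in> torus_L2" if "t \<in> {0..T}" for t using sob that by (simp add: sobolev_alt)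
  have M: "hs_bounded r (fourier_coeff (v t)) M" if t: "t \<in> {0..T}" for t
    using hs_bounded_mono[OF sobolev_hs_bounded, of "v t" r M] sob t cSUP_upper[OF t bdd] by (simp add: M_def)
  have V: "coeff_solution \<mu> T (\<lambda>t. fourier_coeff (v t))"
    by (rule mild_solution_coeff_solution[OF assms(2) mild L2 M])
  have M0: "0 \<le> M" using hs_bounded_nonneg[OF M[of 0]] assms(1) by simp
  have nonneg: "0 \<le> growth_rate r \<mu> M" "0 \<le> local_error_const r \<mu> M"
    using M0 algebra_const_nonneg[of r] by (simp_all add: growth_rate_def local_error_const_def)
  have c0: "0 \<le> ?c" using assms(1) nonneg by (simp add: error_const_def)
  show "\<exists>\<tau>\<^sub>0>0. \<forall>\<tau>. 0 < \<tau> \<and> \<tau> \<le> \<tau>\<^sub>0 \<longrightarrow> (\<forall>n::nat. real n * \<tau> \<le> T \<longrightarrow>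
        ?I \<tau> (v 0) n \<in> sobolev r \<and>
        sobolev_norm r (\<lambda>x. v (real n * \<tau>) x - ?I \<tau> (v 0) n x)
          \<le> error_const r \<mu> T (SUP t\<in>{0..T}. sobolev_norm r (v t)) * \<tau>)"
    unfolding M_def[symmetric]
  \<comment> \<open>The added one avoids a division by zero if the error constant vanishes, for instance for \<open>\<mu> = 0\<close>.\<close>
  proof (intro exI[of _ "1 / (?c + 1)"] conjI allI impI)
    show "0 < 1 / (?c + 1)" using c0 by simp
    fix \<tau> :: real and n :: nat
    assume \<tau>': "0 < \<tau> \<and> \<tau> \<le> 1 / (?c + 1)" and n: "real n * \<tau> \<le> T"
    hence \<tau>: "0 < \<tau>" "?c * \<tau> \<le> 1"
    proof -
      have "?c * \<tau> \<le> (?c + 1) * (1 / (?c + 1))" using \<tau>' c0 by (intro mult_mono) auto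
      thus "?c * \<tau> \<le> 1" using c0 by simp
    qed (use \<tau>' in simp)
    have t: "real n * \<tau> \<in> {0..T}" using n \<tau> by simp
    have v0: "v 0 \<in> torus_L2" using L2[of 0] assms(1) by simp
    note err = integrator_error[OF assms(2) V v0 M \<tau> n]
    have "hs_bounded r (\<lambda>k. fourier_coeff (v (real n * \<tau>)) k - fourier_coeff (?I \<tau> (v 0) n) k) (?c * \<tau>)"
      using err error_accumulation[OF nonneg(2,1), of \<tau> n T] n \<tau>
      by (auto simp: error_const_def elim!: hs_bounded_mono)
    note bound = this
    have I: "?I \<tau> (v 0) n \<in> torus_L2" using err by simp
    have "hs_bounded r (fourier_coeff (?I \<tau> (v 0) n)) (M + ?c * \<tau>)"
      using hs_bounded_diff[OF M[OF t] bound] by simp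
    thus "?I \<tau> (v 0) n \<in> sobolev r" by (rule hs_bounded_sobolev[OF I])
    have "fourier_coeff (\<lambda>x. v (real n * \<tau>) x - ?I \<tau> (v 0) n x)
        = (\<lambda>k. fourier_coeff (v (real n * \<tau>)) k - fourier_coeff (?I \<tau> (v 0) n) k)"
      by (rule ext) (rule fourier_coeff_diff[OF torus_L2_integrable[OF L2[OF t]] torus_L2_integrable[OF I]])
    with bound show "sobolev_norm r (\<lambda>x. v (real n * \<tau>) x - ?I \<tau> (v 0) n x) \<le> ?c * \<tau>"
      by (intro hs_bounded_sobolev_norm_le) simp
  qed
qed

end
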